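(* Let $s_1, s_2, \dots$ be the zeros of the Riemann zeta function $\zeta$ lying on $\{s:\ \mathrm{Re}(s)=\tfrac12,\ \mathrm{Im}(s)>0\}$, listed with multiplicity, let $$h(s)=\frac{1}{2}\prod_{\nu=1}^{\infty}\left(1-\frac{s-s^2}{|s_\nu|^2}\right),$$ and let $\eta$ be the meromorphic function defined by $h(s)=\frac{s}{2}(s-1)\pi^{-s/2}\Gamma(s/2)\eta(s)$. Then the Riemann hypothesis (every zero $s$ of $\zeta$ with $0\le\mathrm{Re}(s)\le1$ satisfies $\mathrm{Re}(s)=\tfrac12$) is true if and only if $\lim_{\sigma\to+\infty}\eta(s)=1$, where $s=\sigma+it$.
   Context: $\Gamma$ denotes the Euler gamma function. *)

theory Defs
  imports "HOL-Complex_Analysis.Complex_Analysis"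
begin

text \<open>
  The Riemann zeta function: the holomorphic continuation to the complex plane without 1 of
  the Dirichlet series. The value at the pole 1 is set to 0, only to make the function unique;
  hence every set of zeros below has to exclude the point 1.
\<close>

definition is_zeta_continuation :: "(complex \<Rightarrow> complex) \<Rightarrow> bool" where
  "is_zeta_continuation f \<longleftrightarrow>
     f holomorphic_on (- {1}) \<and>
     (\<forall>s. Re s > 1 \<longrightarrow> (\<lambda>n. 1 / of_nat (Suc n) powr s) sums f s) \<and>
     f 1 = 0"

lemma is_zeta_continuation_unique:
  assumes "is_zeta_continuation f" "is_zeta_continuation g"
  shows   "f = g"
proof
  fix s :: complex
  have eq: "f w = g w" if "Re w > 1" for w
    using assms that unfolding is_zeta_continuation_def by (meson sums_unique2)
  have op: "open {w. Re w > 1}"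
    by (rule open_halfspace_Re_gt)
  show "f s = g s"
  proof (cases "s = 1")
    case True
    thus ?thesis using assms by (simp add: is_zeta_continuation_def)
  next
    case False
    show ?thesis
    proof (rule analytic_continuation_open[of "{w. Re w > 1}" "- {1}" f g])
      show "connected (- {1 :: complex})"
        by (rule connected_punctured_universe) simp
      show "{w. 1 < Re w} \<noteq> {}"
        by (auto intro!: exI[of _ "2 :: complex"])
      show "f holomorphic_on - {1}" "g holomorphic_on - {1}"
        using assms by (auto simp: is_zeta_continuation_def)
    qed (use eq op False in auto)
  qed
qed

definition zeta :: "complex \<Rightarrow> complex" where
  "zeta = (THE f. is_zeta_continuation f)"

definition zeta_zeros :: "complex set" where
  "zeta_zeros = {s. s \<noteq> 1 \<and> zeta s = 0}"

definition riemann_hypothesis :: bool where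
  "riemann_hypothesis \<longleftrightarrow>
     (\<forall>s \<in> zeta_zeros. 0 \<le> Re s \<and> Re s \<le> 1 \<longrightarrow> Re s = 1 / 2)"

definition critical_line_zeros :: "complex set" where
  "critical_line_zeros = {s \<in> zeta_zeros. Re s = 1 / 2 \<and> Im s > 0}"

definition lists_critical_line_zeros :: "(nat \<Rightarrow> complex) \<Rightarrow> bool" where
  "lists_critical_line_zeros z \<longleftrightarrow>
     range z = critical_line_zeros \<and>
     (\<forall>w \<in> critical_line_zeros. finite {n. z n = w} \<and> int (card {n. z n = w}) = zorder zeta w)"

definition h_prod :: "(nat \<Rightarrow> complex) \<Rightarrow> complex \<Rightarrow> complex" where
  "h_prod z s = 1 / 2 * (\<Prod>n. 1 - (s - s\<^sup>2) / of_real ((cmod (z n))\<^sup>2))"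

text \<open>
  The defining equation is solved for \<open>\<eta>\<close> as an equation between meromorphic functions:
  the pointwise quotient has wrong values where the denominator has a zero or a pole (there
  Isabelle's \<open>Gamma\<close> is 0), e.g. at the removable singularity 0; \<open>remove_sings\<close> corrects them.
\<close>

definition eta_of :: "(nat \<Rightarrow> complex) \<Rightarrow> complex \<Rightarrow> complex" where
  "eta_of z = remove_sings
     (\<lambda>s. h_prod z s / (s / 2 * (s - 1) * of_real pi powr (- s / 2) * Gamma (s / 2)))"

end

theory Submission
  imports Defs "HOL-Real_Asymp.Real_Asymp"
begin

text \<open>
  Put \<open>w = s - s\<^sup>2\<close>. By the theta inversion formula, the completed zeta function
  \<open>s / 2 (s - 1) \<pi>\<^bsup>-s/2\<^esup> \<Gamma>(s/2) \<zeta>(s)\<close> is an entire function \<open>\<Xi>\<close> of \<open>w\<close> with \<open>\<Xi> 0 = 1/2\<close> and order at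
  most \<open>1/2\<close> in \<open>w\<close>. Hence \<open>2 \<Xi>(w)\<close> is the limit of the products of \<open>1 - w / \<rho>\<close> over its
  zeros \<open>|\<rho>| \<le> R\<close>. A zero \<open>s\<^sub>\<nu>\<close> on the critical line gives \<open>\<rho> = |s\<^sub>\<nu>|\<^sup>2\<close>, so \<open>h\<close> collects
  exactly the factors from the critical line. Under the Riemann hypothesis there are no others,
  \<open>\<eta> = \<zeta>\<close>, and \<open>\<zeta> \<rightarrow> 1\<close>. Conversely every \<open>\<rho>\<close> has positive real part, so for \<open>w = -x < 0\<close>, i.e.
  real \<open>s > 1\<close>, every factor has modulus at least 1; a zero \<open>\<rho>\<close> off the line gives
  \<open>|\<zeta>| \<ge> |\<eta>| |1 + x / \<rho>|\<close>, which is incompatible with \<open>\<eta> \<rightarrow> 1\<close> as \<open>x \<rightarrow> \<infinity>\<close>.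
\<close>

section \<open>Theta inversion\<close>

text \<open>The passage from \<open>s\<close> to \<open>w\<close> removes exponential factors. As a
  function of \<open>s\<close> the completed zeta function has order 1, the case of genus one; in
  \<open>w\<close> it grows slower than \<open>exp (e * norm w)\<close> for every
  \<open>e > 0\<close>, and this forces the plain product. The growth bound comes from the doubly
  exponential decay of \<open>psi (exp y)\<close>. The map from \<open>s\<close> to
  \<open>s - s^2\<close> identifies exactly \<open>s\<close> and \<open>1 - s\<close>. On the
  critical line these are conjugate, so \<open>Im > 0\<close> picks one from each pair.
  Multiplicities survive wherever the derivative \<open>1 - 2 * s\<close> does not vanish; the one
  branch point is \<open>s = 1/2\<close>, a point of the critical line that the listing cannot
  contain, so \<open>zeta (1/2)\<close> must be shown to be nonzero. Positivity of
  \<open>Re \<rho>\<close> rests on the absence of zeros in \<open>Re s > 1\<close>, reflected to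
  \<open>Re s < 0\<close>, together with \<open>Xi 0 = 1/2\<close>, which excludes
  \<open>s = 0\<close> and \<open>s = 1\<close>. Convergence of the product in \<open>h\<close> is
  itself extracted from \<open>Xi\<close>: at negative \<open>w\<close> dropping factors only
  decreases the modulus, so partial products are bounded by the full function.\<close>

lemma sum_cis_multiples:
  fixes l :: nat and d :: int
  assumes "l > 0"
  shows "(\<Sum>\<nu><l. cis (2 * pi * real \<nu> * of_int d / real l)) = (if int l dvd d then of_nat l else 0)"
proof -
  define \<omega> where "\<omega> = cis (2 * pi * of_int d / real l)"
  have eq: "cis (2 * pi * real \<nu> * of_int d / real l) = \<omega> ^ \<nu>" for \<nu>
    unfolding \<omega>_def Complex.DeMoivre by (simp add: field_simps)
  have one: "\<omega> = 1 \<longleftrightarrow> int l dvd d"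
  proof
    assume "\<omega> = 1"
    hence "cos (2 * pi * of_int d / real l) = 1"
      by (simp add: \<omega>_def cis.ctr one_complex.ctr)
    then obtain n :: int where "2 * pi * of_int d / real l = of_int n * 2 * pi"
      by (auto simp: cos_one_2pi_int)
    hence "real_of_int d = of_int (n * int l)"
      using assms by (simp add: field_simps)
    hence "d = n * int l" by linarith
    thus "int l dvd d" by simp
  next
    assume "int l dvd d"
    then obtain n where d: "d = int l * n" by auto
    have "2 * pi * of_int d / real l = 2 * pi * of_int n"
      using assms by (simp add: d)
    thus "\<omega> = 1" by (simp add: \<omega>_def cis_multiple_2pi)
  qed
  have pow: "\<omega> ^ l = 1"
  proof -
    have "\<omega> ^ l = cis (2 * pi * of_int d)"
      unfolding \<omega>_def Complex.DeMoivre using assms by simp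
    thus ?thesis by (simp add: cis_multiple_2pi)
  qed
  show ?thesis
  proof (cases "\<omega> = 1")
    case True
    thus ?thesis using one unfolding eq by simp
  next
    case False
    thus ?thesis using one pow unfolding eq by (simp add: geometric_sum)
  qed
qed

text \<open>Writing \<open>2 * cos c\<close> as \<open>cis c + cis (- c)\<close> and expanding
  binomially leaves the frequencies \<open>2 * (k - m) * c\<close>. Summation over
  \<open>\<nu>\<close> is orthogonality of \<open>l\<close>-th roots of unity and keeps the
  \<open>k\<close> congruent to \<open>m\<close> modulo \<open>l\<close>.\<close>

lemma sum_even_power_cos:
  fixes l m :: nat
  assumes "l > 0"
  shows "4 ^ m * (\<Sum>\<nu><l. cos (pi * real \<nu> / real l) ^ (2 * m)) =
         real l * (\<Sum>k | k \<le> 2 * m \<and> int l dvd int k - int m. real (2 * m choose k))"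
proof -
  define c where "c = (\<lambda>\<nu>::nat. pi * real \<nu> / real l)"
  have "complex_of_real (4 ^ m * (\<Sum>\<nu><l. cos (c \<nu>) ^ (2 * m))) =
      (\<Sum>\<nu><l. (cis (c \<nu>) + cis (- c \<nu>)) ^ (2 * m))"
    unfolding sum_distrib_left of_real_sum
  proof (intro sum.cong refl)
    fix \<nu> :: nat
    have "cis (c \<nu>) + cis (- c \<nu>) = of_real (2 * cos (c \<nu>))"
      by (simp add: complex_eq_iff)
    hence "(cis (c \<nu>) + cis (- c \<nu>)) ^ (2 * m) = of_real ((2 * cos (c \<nu>)) ^ (2 * m))"
      by simp
    also have "(2 * cos (c \<nu>)) ^ (2 * m) = 4 ^ m * cos (c \<nu>) ^ (2 * m)"
      unfolding power_mult_distrib by (simp add: power_mult)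
    finally show "complex_of_real (4 ^ m * cos (c \<nu>) ^ (2 * m)) = (cis (c \<nu>) + cis (- c \<nu>)) ^ (2 * m)"
      by simp
  qed
  also have "\<dots> = (\<Sum>\<nu><l. \<Sum>k\<le>2*m. of_nat (2 * m choose k) *
        cis (2 * pi * real \<nu> * of_int (int k - int m) / real l))"
  proof (intro sum.cong refl)
    fix \<nu> :: nat
    have "(cis (c \<nu>) + cis (- c \<nu>)) ^ (2 * m) =
       (\<Sum>k\<le>2*m. of_nat (2 * m choose k) * cis (c \<nu>) ^ k * cis (- c \<nu>) ^ (2 * m - k))"
      by (rule binomial_ring)
    also have "\<dots> = (\<Sum>k\<le>2*m. of_nat (2 * m choose k) *
        cis (2 * pi * real \<nu> * of_int (int k - int m) / real l))"
    proof (intro sum.cong refl)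
      fix k assume k: "k \<in> {..2*m}"
      have "cis (c \<nu>) ^ k * cis (- c \<nu>) ^ (2 * m - k) =
          cis (real k * c \<nu> + real (2 * m - k) * (- c \<nu>))"
        unfolding Complex.DeMoivre cis_mult ..
      also have "real k * c \<nu> + real (2 * m - k) * (- c \<nu>) =
          2 * pi * real \<nu> * of_int (int k - int m) / real l"
        using k assms by (simp add: c_def of_nat_diff field_simps)
      finally show "of_nat (2 * m choose k) * cis (c \<nu>) ^ k * cis (- c \<nu>) ^ (2 * m - k) =
         of_nat (2 * m choose k) * cis (2 * pi * real \<nu> * of_int (int k - int m) / real l)"
        by (simp add: mult.assoc)
    qed
    finally show "(cis (c \<nu>) + cis (- c \<nu>)) ^ (2 * m) = (\<Sum>k\<le>2*m. of_nat (2 * m choose k) *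
        cis (2 * pi * real \<nu> * of_int (int k - int m) / real l))" .
  qed
  also have "\<dots> = (\<Sum>k\<le>2*m. of_nat (2 * m choose k) *
        (\<Sum>\<nu><l. cis (2 * pi * real \<nu> * of_int (int k - int m) / real l)))"
    by (subst sum.swap) (simp add: sum_distrib_left)
  also have "\<dots> = (\<Sum>k\<le>2*m. of_nat (2 * m choose k) *
        (if int l dvd int k - int m then of_nat l else 0))"
    using assms by (simp only: sum_cis_multiples)
  also have "\<dots> = (\<Sum>k\<in>{k. k \<le> 2 * m \<and> int l dvd int k - int m}. of_nat (2 * m choose k) * of_nat l)"
    by (rule sum.mono_neutral_cong_right) auto
  also have "\<dots> = of_real (real l * (\<Sum>k\<in>{k. k \<le> 2 * m \<and> int l dvd int k - int m}. real (2 * m choose k)))"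
    by (simp add: sum_distrib_left mult.commute)
  finally show ?thesis
    by (simp only: of_real_eq_iff c_def)
qed

text \<open>
  Polya's proof of the theta inversion formula: in this finite identity let \<open>p \<rightarrow> \<infinity>\<close> with
  \<open>m \<sim> x l\<^sup>2 / pi\<close>; the two sides become the theta series at \<open>x\<close> and at \<open>1 / x\<close>.
\<close>
lemma sum_even_power_cos_odd:
  fixes p m :: nat
  defines "l \<equiv> 2 * p + 1"
  shows "4 ^ m * (1 + 2 * (\<Sum>\<nu><p. cos (pi * real (Suc \<nu>) / real l) ^ (2 * m))) =
         real l * (real (2 * m choose m) + 2 * (\<Sum>j<m. real (2 * m choose (m + Suc j * l))))"
proof -
  define f where "f = (\<lambda>\<nu>. cos (pi * real \<nu> / real l) ^ (2 * m))"
  have l0: "l > 0" by (simp add: l_def)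
  have f_refl: "f (l - \<nu>) = f \<nu>" if "\<nu> \<le> l" for \<nu>
  proof -
    have "pi * real (l - \<nu>) / real l = pi - pi * real \<nu> / real l"
      using that l0 by (simp add: of_nat_diff field_simps)
    hence "cos (pi * real (l - \<nu>) / real l) = - cos (pi * real \<nu> / real l)"
      by simp
    thus ?thesis by (simp add: f_def)
  qed
  \<comment> \<open>As \<open>l\<close> is odd, the nonzero residues fall into pairs
    \<open>\<nu>\<close>, \<open>l - \<nu>\<close> without a fixed point; both members contribute
    the same even power of a cosine.\<close>
  have "{..<l} = insert 0 (Suc ` {..<p} \<union> (\<lambda>\<nu>. l - Suc \<nu>) ` {..<p})" (is "_ = insert 0 (?A \<union> ?B)")
  proof (intro equalityI subsetI)
    fix \<nu> assume \<nu>: "\<nu> \<in> {..<l}"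
    consider "\<nu> = 0" | "\<nu> > 0" "\<nu> \<le> p" | "\<nu> > p" by linarith
    thus "\<nu> \<in> insert 0 (?A \<union> ?B)"
    proof cases
      case 2
      hence "\<nu> = Suc (\<nu> - 1)" "\<nu> - 1 < p" by auto
      hence "\<nu> \<in> ?A" by blast
      thus ?thesis by blast
    next
      case 3
      with \<nu> have "\<nu> = l - Suc (l - \<nu> - 1)" "l - \<nu> - 1 < p" by (auto simp: l_def)
      hence "\<nu> \<in> ?B" by blast
      thus ?thesis by blast
    qed auto
  qed (auto simp: l_def)
  hence "sum f {..<l} = sum f (insert 0 (?A \<union> ?B))"
    by simp
  also have "\<dots> = f 0 + (sum f ?A + sum f ?B)"
    by (subst sum.insert, force, force simp: l_def, subst sum.union_disjoint) (auto simp: l_def)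
  also have "sum f ?A = (\<Sum>\<nu><p. f (Suc \<nu>))"
    by (subst sum.reindex) auto
  also have "sum f ?B = (\<Sum>\<nu><p. f (l - Suc \<nu>))"
    by (subst sum.reindex) (auto simp: inj_on_def l_def)
  also have "\<dots> = (\<Sum>\<nu><p. f (Suc \<nu>))"
    by (intro sum.cong refl f_refl) (auto simp: l_def)
  finally have lhs: "sum f {..<l} = 1 + 2 * (\<Sum>\<nu><p. f (Suc \<nu>))"
    by (simp add: f_def)
  define g where "g = (\<lambda>k. real (2 * m choose k))"
  \<comment> \<open>The indices congruent to \<open>m\<close> other than \<open>m\<close> itself:
    \<open>C\<close> above, \<open>D\<close> below; symmetry of the binomial coefficients makes
    their contributions equal.\<close>
  define C where "C = (\<lambda>j. m + Suc j * l) ` {j. Suc j * l \<le> m}"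
  define D where "D = (\<lambda>j. m - Suc j * l) ` {j. Suc j * l \<le> m}"
  have jm: "{j. Suc j * l \<le> m} \<subseteq> {..<m}"
  proof
    fix j assume "j \<in> {j. Suc j * l \<le> m}"
    moreover have "Suc j * 1 \<le> Suc j * l" by (rule mult_left_mono) (auto simp: l_def)
    ultimately show "j \<in> {..<m}" by auto
  qed
  have fin: "finite {j. Suc j * l \<le> m}"
    using jm finite_subset by blast
  have "{k. k \<le> 2 * m \<and> int l dvd int k - int m} = insert m (C \<union> D)"
  proof (intro equalityI subsetI)
    fix k assume "k \<in> {k. k \<le> 2 * m \<and> int l dvd int k - int m}"
    hence k: "k \<le> 2 * m" "int l dvd int k - int m" by auto
    consider "k = m" | "k > m" | "k < m" by linarith
    thus "k \<in> insert m (C \<union> D)"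
    proof cases
      case 2
      have "int l dvd int (k - m)" using k 2 by (simp add: of_nat_diff)
      then obtain q where q: "k - m = l * q" by auto
      with 2 have "q > 0" by (cases q) auto
      then obtain j where j: "q = Suc j" by (cases q) auto
      have "k = m + Suc j * l" "Suc j * l \<le> m" using q j 2 k by (auto simp: algebra_simps)
      thus ?thesis by (auto simp: C_def)
    next
      case 3
      have "int l dvd int (m - k)" using k 3 by (simp add: of_nat_diff dvd_diff_commute)
      then obtain q where q: "m - k = l * q" by auto
      with 3 have "q > 0" by (cases q) auto
      then obtain j where j: "q = Suc j" by (cases q) auto
      have "Suc j * l = m - k" using q j by (simp add: mult.commute)
      hence "k = m - Suc j * l" "Suc j * l \<le> m" using 3 by auto
      thus ?thesis by (auto simp: D_def)
    qed auto
  next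
    fix k assume "k \<in> insert m (C \<union> D)"
    thus "k \<in> {k. k \<le> 2 * m \<and> int l dvd int k - int m}"
      by (auto simp: C_def D_def simp del: mult_Suc of_nat_Suc)
  qed
  hence "sum g {k. k \<le> 2 * m \<and> int l dvd int k - int m} = sum g (insert m (C \<union> D))"
    by simp
  also have "\<dots> = g m + (sum g C + sum g D)"
    using l0 fin by (subst sum.insert, force simp: C_def D_def, force simp: C_def D_def,
        subst sum.union_disjoint) (auto simp: C_def D_def)
  also have "sum g C = (\<Sum>j | Suc j * l \<le> m. g (m + Suc j * l))"
    unfolding C_def using l0 by (subst sum.reindex) (auto simp: inj_on_def)
  also have "sum g D = (\<Sum>j | Suc j * l \<le> m. g (m - Suc j * l))"
    unfolding D_def
  proof (subst sum.reindex)
    show "inj_on (\<lambda>j. m - Suc j * l) {j. Suc j * l \<le> m}"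
    proof (rule inj_onI)
      fix i j assume *: "i \<in> {j. Suc j * l \<le> m}" "j \<in> {j. Suc j * l \<le> m}" "m - Suc i * l = m - Suc j * l"
      hence "Suc i * l = Suc j * l" by (metis diff_diff_cancel mem_Collect_eq)
      thus "i = j" using l0 by (simp del: mult_Suc)
    qed
  qed auto
  also have "\<dots> = (\<Sum>j | Suc j * l \<le> m. g (m + Suc j * l))"
  proof (intro sum.cong refl)
    fix j assume "j \<in> {j. Suc j * l \<le> m}"
    hence "2 * m choose (m - Suc j * l) = 2 * m choose (m + Suc j * l)"
      by (subst binomial_symmetric) (auto simp: algebra_simps intro: arg_cong2[of _ _ _ _ "(choose)"])
    thus "g (m - Suc j * l) = g (m + Suc j * l)" by (simp add: g_def)
  qed
  \<comment> \<open>The extra indices have lower entry \<open>m + Suc j * l > 2 * m\<close>, so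
    their binomial coefficients are 0.\<close>
  also have "(\<Sum>j | Suc j * l \<le> m. g (m + Suc j * l)) = (\<Sum>j<m. g (m + Suc j * l))"
    by (rule sum.mono_neutral_left) (use jm in \<open>auto simp: g_def\<close>)
  finally have rhs: "sum g {k. k \<le> 2 * m \<and> int l dvd int k - int m} =
      g m + 2 * (\<Sum>j<m. g (m + Suc j * l))" by simp
  show ?thesis
    using sum_even_power_cos[OF l0, of m] lhs rhs by (simp only: f_def g_def)
qed

text \<open>Successive ratios are
  \<open>(m - k) / (m + k + 1) = 1 - (2 * k + 1) / (m + k + 1)\<close>, with reciprocal
  \<open>1 + (2 * k + 1) / (m - k)\<close>. Applying \<open>1 + x \<le> exp x\<close> to either form
  and adding up the odd numbers \<open>1 + 3 + ... = k^2\<close> gives Gaussian bounds;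
  \<open>K\<close> makes the denominators uniform along the induction.\<close>

lemma binomial_shift_ratio_bounds:
  fixes m K k :: nat
  defines "q \<equiv> (\<lambda>k. real (2 * m choose (m + k)) / real (2 * m choose m))"
  assumes "K \<le> m" "k \<le> K"
  shows "exp (- (real k ^ 2 / real (m - K + 1))) \<le> q k" "q k \<le> exp (- (real k ^ 2 / real (m + K)))"
proof -
  have step: "q (Suc k) = q k * ((real m - real k) / (real m + real k + 1))" if "k < K" for k
  proof -
    have "Suc (m + k) * (2 * m choose Suc (m + k)) = (2 * m - (m + k)) * (2 * m choose (m + k))"
      by (metis binomial_absorb_comp binomial_absorption)
    moreover have "2 * m - (m + k) = m - k" by simp
    ultimately have "real (Suc (m + k)) * real (2 * m choose Suc (m + k)) = real (m - k) * real (2 * m choose (m + k))"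
      by (metis of_nat_mult)
    moreover have "k \<le> m" using that assms by simp
    ultimately have "(real m + real k + 1) * real (2 * m choose Suc (m + k)) = (real m - real k) * real (2 * m choose (m + k))"
      by (simp add: of_nat_diff algebra_simps)
    hence "real (2 * m choose Suc (m + k)) = (real m - real k) * real (2 * m choose (m + k)) / (real m + real k + 1)"
      by (simp add: nonzero_eq_divide_eq mult.commute)
    thus ?thesis
      by (simp add: q_def mult_ac)
  qed
  have "exp (- (real k ^ 2 / real (m - K + 1))) \<le> q k \<and> q k \<le> exp (- (real k ^ 2 / real (m + K)))"
    using assms(3)
  proof (induction k)
    case 0
    show ?case by (simp add: q_def)
  next
    case (Suc k)
    hence k: "k < K" "k < m" using assms by auto
    define r where "r = (real m - real k) / (real m + real k + 1)"
    have r0: "r \<ge> 0" using k by (simp add: r_def)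
    have "r = 1 + (- ((2 * real k + 1) / (real m + real k + 1)))"
      by (simp add: r_def field_simps)
    also have "\<dots> \<le> exp (- ((2 * real k + 1) / (real m + real k + 1)))"
      by (rule exp_ge_add_one_self)
    also have "\<dots> \<le> exp (- ((2 * real k + 1) / real (m + K)))"
    proof -
      have "(2 * real k + 1) / real (m + K) \<le> (2 * real k + 1) / (real m + real k + 1)"
        by (rule divide_left_mono) (use k in \<open>auto intro!: mult_pos_pos\<close>)
      thus ?thesis by simp
    qed
    finally have r_le: "r \<le> exp (- ((2 * real k + 1) / real (m + K)))" .
    have "exp (- ((2 * real k + 1) / real (m - K + 1))) \<le> exp (- ((2 * real k + 1) / (real m - real k)))"
    proof -
      have "(2 * real k + 1) / (real m - real k) \<le> (2 * real k + 1) / real (m - K + 1)"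
        by (rule divide_left_mono) (use k assms in \<open>auto intro!: mult_pos_pos simp: of_nat_diff\<close>)
      thus ?thesis by simp
    qed
    also have "\<dots> = 1 / exp ((2 * real k + 1) / (real m - real k))"
      by (simp add: exp_minus inverse_eq_divide)
    also have "\<dots> \<le> 1 / (1 + (2 * real k + 1) / (real m - real k))"
      by (rule divide_left_mono[OF exp_ge_add_one_self])
         (use k in \<open>auto intro!: mult_pos_pos add_pos_nonneg divide_nonneg_nonneg\<close>)
    also have "\<dots> = r" using k by (simp add: r_def field_simps)
    finally have r_ge: "exp (- ((2 * real k + 1) / real (m - K + 1))) \<le> r" .
    have sq: "real (Suc k) ^ 2 / c = real k ^ 2 / c + (2 * real k + 1) / c" for c :: real
      by (simp add: power2_eq_square add_divide_distrib[symmetric] algebra_simps)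
    have IH: "exp (- (real k ^ 2 / real (m - K + 1))) \<le> q k" "q k \<le> exp (- (real k ^ 2 / real (m + K)))"
      using Suc by auto
    have "exp (- (real (Suc k) ^ 2 / real (m - K + 1))) \<le> q k * r"
      unfolding sq minus_add_distrib exp_add
      by (rule mult_mono[OF IH(1) r_ge]) (auto simp: q_def)
    moreover have "q k * r \<le> exp (- (real (Suc k) ^ 2 / real (m + K)))"
      unfolding sq minus_add_distrib exp_add
      by (rule mult_mono[OF IH(2) r_le]) (use r0 in auto)
    ultimately show ?case
      using step[OF k(1)] by (simp add: r_def)
  qed
  thus "exp (- (real k ^ 2 / real (m - K + 1))) \<le> q k" "q k \<le> exp (- (real k ^ 2 / real (m + K)))"
    by auto
qed

text \<open>With \<open>c n\<close> the normalised central binomial coefficient, the partial Wallis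
  products are exactly \<open>1 / (c n ^ 2 * (2 * n + 1))\<close>.\<close>

lemma central_binomial_asymp:
  "(\<lambda>m. sqrt (real m) * real (2 * m choose m) / 4 ^ m) \<longlonglongrightarrow> 1 / sqrt pi"
proof -
  define c where "c = (\<lambda>m. real (2 * m choose m) / 4 ^ m)"
  have c_pos: "c m > 0" for m by (simp add: c_def)
  have c_Suc: "c (Suc m) = c m * ((2 * real m + 1) / (2 * real m + 2))" for m
  proof -
    have "Suc m * Suc m * (2 * Suc m choose Suc m) = 2 * Suc m * (2 * m + 1) * (2 * m choose m)"
    proof -
      have a: "Suc m * (Suc (Suc (2 * m)) choose Suc m) = Suc (Suc (2 * m)) * (Suc (2 * m) choose m)"
        by (rule Suc_times_binomial)
      have s: "Suc (2 * m) choose m = Suc (2 * m) choose Suc m"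
        by (subst binomial_symmetric) auto
      have b: "Suc m * (Suc (2 * m) choose Suc m) = Suc (2 * m) * ((2 * m) choose m)"
        by (rule Suc_times_binomial)
      have "Suc m * Suc m * (2 * Suc m choose Suc m) = Suc m * (Suc m * (Suc (Suc (2 * m)) choose Suc m))"
      proof -
        have "2 * Suc m = Suc (Suc (2 * m))" by simp
        thus ?thesis by (simp only: mult.assoc)
      qed
      also have "\<dots> = Suc (Suc (2 * m)) * (Suc m * (Suc (2 * m) choose Suc m))"
        unfolding a s by (simp only: mult.left_commute)
      also have "\<dots> = Suc (Suc (2 * m)) * (Suc (2 * m) * ((2 * m) choose m))"
        unfolding b ..
      also have "\<dots> = 2 * Suc m * (2 * m + 1) * (2 * m choose m)"
        by (simp only: mult.assoc[symmetric]) simp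
      finally show ?thesis .
    qed
    hence "real (Suc m) * real (Suc m) * real (2 * Suc m choose Suc m) =
       2 * real (Suc m) * (2 * real m + 1) * real (2 * m choose m)"
      by (metis (no_types, lifting) of_nat_mult of_nat_add of_nat_1 of_nat_numeral)
    hence "real (Suc m) * (real (Suc m) * real (2 * Suc m choose Suc m)) =
       real (Suc m) * (2 * (2 * real m + 1) * real (2 * m choose m))"
      by (simp only: mult.assoc mult.left_commute)
    hence "real (Suc m) * real (2 * Suc m choose Suc m) = 2 * (2 * real m + 1) * real (2 * m choose m)"
      unfolding mult_cancel_left by simp
    hence "real (2 * Suc m choose Suc m) = 2 * (2 * real m + 1) * real (2 * m choose m) / real (Suc m)"
      by (simp only: nonzero_eq_divide_eq of_nat_eq_0_iff nat.simps mult.commute simp_thms)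
    thus ?thesis unfolding c_def by (simp only:) (simp add: divide_simps, simp add: algebra_simps)
  qed
  have "(\<Prod>k=1..n. (4*real k^2) / (4*real k^2 - 1)) = 1 / (c n ^ 2 * (2 * real n + 1))" for n
  proof (induction n)
    case 0
    show ?case by (simp add: c_def)
  next
    case (Suc n)
    have "(\<Prod>k=1..Suc n. (4*real k^2) / (4*real k^2 - 1)) =
      (4*real (Suc n)^2) / (4*real (Suc n)^2 - 1) * (1 / (c n ^ 2 * (2 * real n + 1)))"
    proof -
      have "{1..Suc n} = insert (Suc n) {1..n}" by auto
      thus ?thesis using Suc by (simp del: of_nat_Suc)
    qed
    also have "4*real (Suc n)^2 - 1 = (2 * real n + 1) * (2 * real n + 3)"
      by (simp add: power2_eq_square algebra_simps)
    also have "4*real (Suc n)^2 / ((2 * real n + 1) * (2 * real n + 3)) * (1 / (c n ^ 2 * (2 * real n + 1))) =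
      1 / (c (Suc n) ^ 2 * (2 * real (Suc n) + 1))"
      unfolding c_Suc using c_pos[of n]
      by (simp add: divide_simps add_pos_nonneg) (simp add: power2_eq_square algebra_simps)
    finally show ?case .
  qed
  hence "(\<lambda>n. 1 / (c n ^ 2 * (2 * real n + 1))) \<longlonglongrightarrow> pi / 2"
    using wallis by simp
  hence "(\<lambda>n. sqrt (real n / (2 * real n + 1) / (1 / (c n ^ 2 * (2 * real n + 1))))) \<longlonglongrightarrow> sqrt (1 / 2 / (pi / 2))"
  proof -
    assume lim: "(\<lambda>n. 1 / (c n ^ 2 * (2 * real n + 1))) \<longlonglongrightarrow> pi / 2"
    have "(\<lambda>n. real n / (2 * real n + 1)) \<longlonglongrightarrow> 1 / 2" by real_asymp
    from tendsto_real_sqrt[OF tendsto_divide[OF this lim]] show ?thesis by simp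
  qed
  also have "(\<lambda>n. sqrt (real n / (2 * real n + 1) / (1 / (c n ^ 2 * (2 * real n + 1))))) = (\<lambda>n. sqrt (real n) * c n)"
  proof
    fix n
    have "real n / (2 * real n + 1) / (1 / (c n ^ 2 * (2 * real n + 1))) = real n * c n ^ 2"
      using c_pos[of n] by (simp add: divide_simps)
    thus "sqrt (real n / (2 * real n + 1) / (1 / (c n ^ 2 * (2 * real n + 1)))) = sqrt (real n) * c n"
      using c_pos[of n] by (simp add: real_sqrt_mult)
  qed
  finally show ?thesis by (simp add: c_def real_sqrt_divide)
qed

text \<open>The Jacobi theta series over all integers is \<open>1 + 2 * psi x\<close>.\<close>

definition psi :: "real \<Rightarrow> real" where
  "psi x = (\<Sum>n. exp (- (pi * real (Suc n) ^ 2 * x)))"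

text \<open>A weak form of Jordan's inequality: \<open>y - y^3 / 6\<close> with
  \<open>y \<le> 2\<close>. The constant \<open>1/3\<close> is convenient because
  \<open>pi / 3 > 1\<close> later absorbs it.\<close>

lemma third_le_sin:
  fixes y :: real
  assumes "0 \<le> y" "y \<le> pi / 2"
  shows "y / 3 \<le> sin y"
proof -
  have "\<bar>sin y - (\<Sum>m<3. sin_coeff m * y ^ m)\<bar> \<le> inverse (fact 3) * \<bar>y\<bar> ^ 3"
    by (rule Maclaurin_sin_bound)
  also have "(\<Sum>m<3. sin_coeff m * y ^ m) = y"
    by (simp add: eval_nat_numeral sin_coeff_def)
  finally have "sin y \<ge> y - y ^ 3 / 6"
    using assms abs_ge_minus_self[of "sin y - y"] by (simp add: fact_numeral field_simps)
  moreover have "y ^ 3 \<le> 4 * y"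
  proof -
    have "y \<le> 2" using assms pi_less_4 by simp
    hence "y * y \<le> 2 * 2" using assms by (intro mult_mono) auto
    hence "y * (y * y) \<le> y * 4" using assms by (intro mult_left_mono) auto
    thus ?thesis by (simp add: power3_eq_cube mult_ac)
  qed
  ultimately show ?thesis by linarith
qed

lemma theta_inversion:
  fixes x :: real
  assumes x: "x > 0"
  shows "1 + 2 * psi x = (1 + 2 * psi (1 / x)) / sqrt x"
proof -
  \<comment> \<open>With \<open>m / l^2\<close> tending to \<open>t\<close>, the cosine powers tend
    to \<open>exp (- pi^2 n^2 t)\<close> and the binomial ratios to \<open>exp (- n^2 / t)\<close>;
    \<open>t = x / pi\<close> turns these into the terms of the series at \<open>x\<close> and at
    \<open>1 / x\<close>.\<close>
  define t where "t = x / pi"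
  have t: "t > 0" using x by (simp add: t_def)
  define l where "l = (\<lambda>p::nat. 2 * p + 1)"
  define m where "m = (\<lambda>p. nat \<lfloor>t * real (l p) ^ 2\<rfloor>)"
  have l_pos: "real (l p) > 0" for p by (simp add: l_def)
  have m_le: "real (m p) \<le> t * real (l p) ^ 2" for p
    using t by (simp add: m_def)
  have m_ge: "real (m p) \<ge> t * real (l p) ^ 2 - 1" for p
    using t unfolding m_def by linarith
  have lim_l: "filterlim (\<lambda>p. real (l p)) at_top sequentially"
    unfolding l_def by real_asymp
  have lim_m: "(\<lambda>p. real (m p) / real (l p) ^ 2) \<longlonglongrightarrow> t"
  proof (rule real_tendsto_sandwich)
    show "(\<lambda>p. t - 1 / real (l p) ^ 2) \<longlonglongrightarrow> t" unfolding l_def by real_asymp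
    show "(\<lambda>_. t) \<longlonglongrightarrow> t" by simp
    show "eventually (\<lambda>p. t - 1 / real (l p) ^ 2 \<le> real (m p) / real (l p) ^ 2) sequentially"
    proof (intro always_eventually allI)
      fix p
      have "t - 1 / real (l p) ^ 2 = (t * real (l p) ^ 2 - 1) / real (l p) ^ 2"
        using l_pos[of p] by (simp add: field_simps)
      also have "\<dots> \<le> real (m p) / real (l p) ^ 2"
        using m_ge[of p] by (intro divide_right_mono) auto
      finally show "t - 1 / real (l p) ^ 2 \<le> real (m p) / real (l p) ^ 2" .
    qed
    show "eventually (\<lambda>p. real (m p) / real (l p) ^ 2 \<le> t) sequentially"
      using l_pos m_le by (intro always_eventually allI) (auto simp: field_simps)
  qed
  have m_infty: "filterlim m at_top sequentially"
  proof -
    have "filterlim (\<lambda>p. real (m p) / real (l p) ^ 2 * real (l p) ^ 2) at_top sequentially"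
      by (rule filterlim_tendsto_pos_mult_at_top[OF lim_m t])
         (intro filterlim_pow_at_top lim_l, simp)
    moreover have "real (m p) / real (l p) ^ 2 * real (l p) ^ 2 = real (m p)" for p
      using l_pos[of p] by simp
    ultimately have "filterlim (\<lambda>p. real (m p)) at_top sequentially" by simp
    thus ?thesis by (simp add: filterlim_sequentially_iff_filterlim_real)
  qed

  define A where "A = (\<lambda>\<nu> p. if \<nu> < p then cos (pi * real (Suc \<nu>) / real (l p)) ^ (2 * m p) else 0)"
  have A_lim: "(\<lambda>p. A \<nu> p) \<longlonglongrightarrow> exp (- (pi * real (Suc \<nu>) ^ 2 * x))" for \<nu>
  proof -
    define a where "a = pi * real (Suc \<nu>)"
    have a: "a > 0" by (simp add: a_def)
    have "(\<lambda>p. exp (real (m p) / real (l p) ^ 2 * (real (l p) ^ 2 * (2 * ln (cos (a / real (l p))))))) \<longlonglongrightarrow>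
        exp (t * (- (a ^ 2)))"
    proof (intro tendsto_intros lim_m)
      show "(\<lambda>p. real (l p) ^ 2 * (2 * ln (cos (a / real (l p))))) \<longlonglongrightarrow> - (a ^ 2)"
        using a unfolding l_def power2_eq_square by real_asymp
    qed
    moreover have "eventually (\<lambda>p. exp (real (m p) / real (l p) ^ 2 * (real (l p) ^ 2 * (2 * ln (cos (a / real (l p)))))) = A \<nu> p) sequentially"
    proof -
      have "eventually (\<lambda>p. cos (a / real (l p)) > 0) sequentially"
        using a unfolding l_def by real_asymp
      moreover have "eventually (\<lambda>p. p > \<nu>) sequentially"
        by (rule eventually_gt_at_top)
      ultimately show ?thesis
      proof eventually_elim
        case (elim p)
        have "A \<nu> p = cos (a / real (l p)) ^ (2 * m p)"
          using elim by (simp add: A_def a_def)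
        also have "\<dots> = exp (real (2 * m p) * ln (cos (a / real (l p))))"
          by (subst exp_of_nat_mult) (simp add: elim(1))
        finally show ?case using l_pos[of p] by (simp add: mult_ac)
      qed
    qed
    ultimately have "(\<lambda>p. A \<nu> p) \<longlonglongrightarrow> exp (t * (- (a ^ 2)))"
      using tendsto_cong by fastforce
    also have "t * (- (a ^ 2)) = - (pi * real (Suc \<nu>) ^ 2 * x)"
      by (simp add: t_def a_def power2_eq_square)
    finally show ?thesis .
  qed
  \<comment> \<open>A majorant uniform in all large \<open>p\<close> lets Tannery's theorem exchange
    limit and sum. It comes from \<open>cos^2 = 1 - sin^2 \<le> exp (- sin^2)\<close>; the argument
    stays below \<open>pi / 2\<close> because \<open>2 * Suc \<nu> \<le> l p\<close>.\<close>
  have A_bound: "eventually (\<lambda>p. \<forall>\<nu>. norm (A \<nu> p) \<le> exp (- (t / 2)) ^ \<nu>) sequentially"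
  proof -
    have "eventually (\<lambda>p. real (m p) / real (l p) ^ 2 > t / 2) sequentially"
      by (rule order_tendstoD(1)[OF lim_m]) (use t in simp)
    thus ?thesis
    proof eventually_elim
      case (elim p)
      show ?case
      proof
        fix \<nu>
        show "norm (A \<nu> p) \<le> exp (- (t / 2)) ^ \<nu>"
        proof (cases "\<nu> < p")
          case True
          define y where "y = pi * real (Suc \<nu>) / real (l p)"
          have y: "0 \<le> y" "y \<le> pi / 2"
          proof -
            have "pi * real (Suc \<nu>) \<le> pi / 2 * real (l p)"
            proof -
              have "2 * real (Suc \<nu>) \<le> real (l p)" using True by (simp add: l_def)
              hence "pi * (2 * real (Suc \<nu>)) \<le> pi * real (l p)" by (intro mult_left_mono) auto
              thus ?thesis by simp
            qed
            thus "y \<le> pi / 2" using l_pos[of p] by (simp add: y_def pos_divide_le_eq)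
          qed (simp add: y_def)
          have "A \<nu> p = (cos y ^ 2) ^ m p"
            using True by (simp add: A_def y_def power_mult)
          also have "cos y ^ 2 = 1 + (- (sin y ^ 2))"
            by (simp add: cos_squared_eq)
          also have "(1 + (- (sin y ^ 2))) ^ m p \<le> exp (- (sin y ^ 2)) ^ m p"
            by (rule power_mono[OF exp_ge_add_one_self]) (simp flip: cos_squared_eq)
          also have "\<dots> = exp (- (real (m p) * sin y ^ 2))"
            by (simp flip: exp_of_nat_mult)
          also have "\<dots> \<le> exp (- (real (m p) * (y / 3) ^ 2))"
            using third_le_sin[OF y] y by (auto intro!: mult_left_mono power_mono)
          also have "real (m p) * (y / 3) ^ 2 = real (m p) / real (l p) ^ 2 * ((pi / 3) ^ 2 * real (Suc \<nu>) ^ 2)"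
            by (simp add: y_def power_divide power_mult_distrib)
          also have "exp (- (real (m p) / real (l p) ^ 2 * ((pi / 3) ^ 2 * real (Suc \<nu>) ^ 2))) \<le>
             exp (- (t / 2 * (1 * real \<nu>)))"
          proof -
            have "1 * real \<nu> \<le> (pi / 3) ^ 2 * real (Suc \<nu>) ^ 2"
            proof (rule mult_mono)
              show "1 \<le> (pi / 3) ^ 2" using pi_gt3 by (intro one_le_power) simp
              show "real \<nu> \<le> real (Suc \<nu>) ^ 2"
                by (simp add: power2_eq_square algebra_simps)
            qed auto
            from mult_mono[OF less_imp_le[OF elim] this]
            have "t / 2 * (1 * real \<nu>) \<le> real (m p) / real (l p) ^ 2 * ((pi / 3) ^ 2 * real (Suc \<nu>) ^ 2)"
              by simp
            thus ?thesis by simp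
          qed
          also have "exp (- (t / 2 * (1 * real \<nu>))) = exp (- (t / 2)) ^ \<nu>"
            by (simp flip: exp_of_nat_mult add: mult_ac)
          finally have "A \<nu> p \<le> exp (- (t / 2)) ^ \<nu>" .
          moreover have "A \<nu> p \<ge> 0" using True by (simp add: A_def)
          ultimately show ?thesis by simp
        qed (auto simp: A_def)
      qed
    qed
  qed
  have "(\<lambda>p. \<Sum>\<nu>. A \<nu> p) \<longlonglongrightarrow> (\<Sum>\<nu>. exp (- (pi * real (Suc \<nu>) ^ 2 * x)))"
  proof -
    have "eventually (\<lambda>(\<nu>, p). norm (A \<nu> p) \<le> exp (- (t / 2)) ^ \<nu>) (at_top \<times>\<^sub>F sequentially)"
      unfolding eventually_prod_filter
      by (intro exI[of _ "\<lambda>_. True"] exI[of _ "\<lambda>p. \<forall>\<nu>. norm (A \<nu> p) \<le> exp (- (t / 2)) ^ \<nu>"])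
         (use A_bound in auto)
    from tannerys_theorem[OF A_lim this] t show ?thesis
      by (simp add: summable_geometric)
  qed
  hence A_sum: "(\<lambda>p. 1 + 2 * (\<Sum>\<nu>. A \<nu> p)) \<longlonglongrightarrow> 1 + 2 * psi x"
    unfolding psi_def by (intro tendsto_intros)

  define B where "B = (\<lambda>j p. if j < m p then real (2 * m p choose (m p + Suc j * l p)) / real (2 * m p choose m p) else 0)"
  have B_lim: "(\<lambda>p. B j p) \<longlonglongrightarrow> exp (- (pi * real (Suc j) ^ 2 * (1 / x)))" for j
  proof -
    define a where "a = real (Suc j)"
    have a: "a > 0" by (simp add: a_def)
    have ev: "eventually (\<lambda>p. Suc j * l p \<le> m p \<and> j < m p) sequentially"
    proof -
      have "eventually (\<lambda>p. real (m p) / real (l p) ^ 2 > t / 2) sequentially"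
        by (rule order_tendstoD(1)[OF lim_m]) (use t in simp)
      moreover have "eventually (\<lambda>p. a * real (l p) \<le> t / 2 * real (l p) ^ 2) sequentially"
        using a t unfolding l_def by real_asymp
      ultimately show ?thesis
      proof eventually_elim
        case (elim p)
        have "real (Suc j * l p) \<le> t / 2 * real (l p) ^ 2"
          using elim(2) unfolding a_def of_nat_mult .
        also have "\<dots> \<le> real (m p)"
          using elim(1) l_pos[of p] by (simp add: field_simps)
        finally have 1: "Suc j * l p \<le> m p" by linarith
        have "Suc j * 1 \<le> Suc j * l p" by (intro mult_left_mono) (auto simp: l_def)
        with 1 show ?case by simp
      qed
    qed
    show ?thesis
    proof (rule real_tendsto_sandwich)
      define u where "u = (\<lambda>p. real (m p) / real (l p) ^ 2)"
      have u_lim: "u \<longlonglongrightarrow> t" using lim_m by (simp add: u_def)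
      have al: "(\<lambda>p. a / real (l p)) \<longlonglongrightarrow> 0" "(\<lambda>p. 1 / real (l p) ^ 2) \<longlonglongrightarrow> 0"
        unfolding l_def by real_asymp+
      show "(\<lambda>p. exp (- (a ^ 2 / (u p - a / real (l p) + 1 / real (l p) ^ 2)))) \<longlonglongrightarrow> exp (- (pi * real (Suc j) ^ 2 * (1 / x)))"
      proof -
        have "(\<lambda>p. exp (- (a ^ 2 / (u p - a / real (l p) + 1 / real (l p) ^ 2)))) \<longlonglongrightarrow> exp (- (a ^ 2 / (t - 0 + 0)))"
          by (intro tendsto_exp tendsto_minus tendsto_divide tendsto_add tendsto_diff u_lim al tendsto_const)
             (use t in simp)
        thus ?thesis by (simp add: t_def a_def field_simps)
      qed
      show "(\<lambda>p. exp (- (a ^ 2 / (u p + a / real (l p))))) \<longlonglongrightarrow> exp (- (pi * real (Suc j) ^ 2 * (1 / x)))"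
      proof -
        have "(\<lambda>p. exp (- (a ^ 2 / (u p + a / real (l p))))) \<longlonglongrightarrow> exp (- (a ^ 2 / (t + 0)))"
          by (intro tendsto_exp tendsto_minus tendsto_divide tendsto_add tendsto_diff u_lim al tendsto_const)
             (use t in simp)
        thus ?thesis by (simp add: t_def a_def field_simps)
      qed
      show "eventually (\<lambda>p. exp (- (a ^ 2 / (u p - a / real (l p) + 1 / real (l p) ^ 2))) \<le> B j p) sequentially"
        using ev
      proof eventually_elim
        case (elim p)
        have "real (Suc j * l p) ^ 2 / real (m p - Suc j * l p + 1) = a ^ 2 / (u p - a / real (l p) + 1 / real (l p) ^ 2)"
        proof -
          have "u p - a / real (l p) + 1 / real (l p) ^ 2 = real (m p - Suc j * l p + 1) / real (l p) ^ 2"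
          proof -
            have "real (m p - Suc j * l p + 1) = real (m p) - a * real (l p) + 1"
              using elim by (simp add: a_def of_nat_diff del: mult_Suc)
            thus ?thesis using l_pos[of p]
              by (simp only:) (simp add: u_def power2_eq_square field_simps)
          qed
          thus ?thesis by (simp add: a_def power_mult_distrib del: mult_Suc of_nat_Suc)
        qed
        thus ?case using binomial_shift_ratio_bounds(1)[of "Suc j * l p" "m p" "Suc j * l p"] elim
          by (simp add: B_def del: mult_Suc)
      qed
      show "eventually (\<lambda>p. B j p \<le> exp (- (a ^ 2 / (u p + a / real (l p))))) sequentially"
        using ev
      proof eventually_elim
        case (elim p)
        have "real (Suc j * l p) ^ 2 / real (m p + Suc j * l p) = a ^ 2 / (u p + a / real (l p))"
        proof -
          have "u p + a / real (l p) = real (m p + Suc j * l p) / real (l p) ^ 2"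
            using l_pos[of p] by (simp add: u_def a_def power2_eq_square field_simps del: mult_Suc of_nat_Suc)
          thus ?thesis by (simp add: a_def power_mult_distrib del: mult_Suc of_nat_Suc)
        qed
        thus ?case using binomial_shift_ratio_bounds(2)[of "Suc j * l p" "m p" "Suc j * l p"] elim
          by (simp add: B_def del: mult_Suc)
      qed
    qed
  qed
  \<comment> \<open>For \<open>k = Suc j * l p\<close> with \<open>k \<le> m p\<close>, the
    denominator \<open>m p + k\<close> is at most \<open>2 * t * l^2\<close>, so the exponent is at
    least \<open>(Suc j)^2 / (2 * t)\<close>, whatever \<open>p\<close> is.\<close>
  have B_bound: "norm (B j p) \<le> exp (- (1 / (2 * t))) ^ j" for j p
  proof (cases "Suc j * l p \<le> m p")
    case True
    define k where "k = Suc j * l p"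
    have k: "k \<le> m p" "k > 0" using True by (auto simp: k_def l_def)
    have "norm (B j p) \<le> real (2 * m p choose (m p + k)) / real (2 * m p choose m p)"
      by (simp add: B_def k_def)
    also have "\<dots> \<le> exp (- (real k ^ 2 / real (m p + k)))"
      by (rule binomial_shift_ratio_bounds(2)) (use k in auto)
    also have "\<dots> \<le> exp (- (1 / (2 * t) * real j))"
    proof -
      have "1 / (2 * t) * real j \<le> 1 / (2 * t) * real (Suc j) ^ 2"
        using t by (intro mult_left_mono) (auto simp: power2_eq_square algebra_simps)
      also have "\<dots> = real k ^ 2 / (2 * (t * real (l p) ^ 2))"
        using l_pos[of p] by (simp add: k_def power_mult_distrib del: mult_Suc of_nat_Suc)
      also have "\<dots> \<le> real k ^ 2 / real (m p + k)"
        using k m_le[of p] by (intro divide_left_mono) (auto intro!: mult_pos_pos t l_pos)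
      finally show ?thesis by simp
    qed
    also have "\<dots> = exp (- (1 / (2 * t))) ^ j"
      by (simp flip: exp_of_nat_mult add: mult_ac)
    finally show ?thesis .
  next
    case False
    hence "B j p = 0" by (simp add: B_def del: mult_Suc)
    thus ?thesis by simp
  qed
  have "(\<lambda>p. \<Sum>j. B j p) \<longlonglongrightarrow> (\<Sum>j. exp (- (pi * real (Suc j) ^ 2 * (1 / x))))"
  proof -
    have "eventually (\<lambda>(j, p). norm (B j p) \<le> exp (- (1 / (2 * t))) ^ j) (at_top \<times>\<^sub>F sequentially)"
      using B_bound by (intro always_eventually) auto
    from tannerys_theorem[OF B_lim this] t show ?thesis
      by (simp add: summable_geometric)
  qed
  hence B_sum: "(\<lambda>p. 1 + 2 * (\<Sum>j. B j p)) \<longlonglongrightarrow> 1 + 2 * psi (1 / x)"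
    unfolding psi_def by (intro tendsto_intros)

  define c where "c = (\<lambda>m. real (2 * m choose m) / 4 ^ m)"
  \<comment> \<open>The prefactor of the finite identity supplies the square root: by the central
    binomial asymptotics it tends to \<open>1 / sqrt (pi * t)\<close>.\<close>
  have c_lim: "(\<lambda>p. real (l p) * c (m p)) \<longlonglongrightarrow> 1 / sqrt x"
  proof -
    have "(\<lambda>p. sqrt (real (m p)) * real (2 * m p choose m p) / 4 ^ m p / sqrt (real (m p) / real (l p) ^ 2)) \<longlonglongrightarrow>
        1 / sqrt pi / sqrt t"
      using tendsto_divide[OF filterlim_compose[OF central_binomial_asymp m_infty] tendsto_real_sqrt[OF lim_m]] t
      by simp
    moreover have "eventually (\<lambda>p. sqrt (real (m p)) * real (2 * m p choose m p) / 4 ^ m p / sqrt (real (m p) / real (l p) ^ 2) =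
        real (l p) * c (m p)) sequentially"
    proof -
      have "eventually (\<lambda>p. m p > 0) sequentially"
        by (rule eventually_compose_filterlim[OF eventually_gt_at_top m_infty])
      thus ?thesis
        by eventually_elim (use l_pos in \<open>simp add: c_def real_sqrt_divide\<close>)
    qed
    ultimately have "(\<lambda>p. real (l p) * c (m p)) \<longlonglongrightarrow> 1 / sqrt pi / sqrt t"
      using tendsto_cong by fastforce
    also have "1 / sqrt pi / sqrt t = 1 / sqrt x"
      using x by (simp add: t_def real_sqrt_divide)
    finally show ?thesis .
  qed
  have "1 + 2 * (\<Sum>\<nu>. A \<nu> p) = real (l p) * c (m p) * (1 + 2 * (\<Sum>j. B j p))" for p
  proof -
    have "(\<Sum>\<nu>. A \<nu> p) = (\<Sum>\<nu><p. cos (pi * real (Suc \<nu>) / real (l p)) ^ (2 * m p))"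
      by (subst suminf_finite[of "{..<p}"]) (auto simp: A_def)
    moreover have "(\<Sum>j. B j p) = (\<Sum>j<m p. real (2 * m p choose (m p + Suc j * l p))) / real (2 * m p choose m p)"
      by (subst suminf_finite[of "{..<m p}"]) (auto simp: B_def sum_divide_distrib)
    moreover have "4 ^ m p * (1 + 2 * (\<Sum>\<nu><p. cos (pi * real (Suc \<nu>) / real (l p)) ^ (2 * m p))) =
         real (l p) * (real (2 * m p choose m p) + 2 * (\<Sum>j<m p. real (2 * m p choose (m p + Suc j * l p))))"
      unfolding l_def by (rule sum_even_power_cos_odd)
    ultimately show ?thesis
      by (simp add: c_def field_simps del: mult_Suc of_nat_Suc)
  qed
  hence "(\<lambda>p. 1 + 2 * (\<Sum>\<nu>. A \<nu> p)) \<longlonglongrightarrow> 1 / sqrt x * (1 + 2 * psi (1 / x))"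
    using tendsto_mult[OF c_lim B_sum] by simp
  from LIMSEQ_unique[OF A_sum this] show ?thesis by simp
qed

section \<open>Mellin transform of the theta series\<close>

lemma summable_psi:
  assumes "x > 0"
  shows "summable (\<lambda>n. exp (- (pi * real (Suc n) ^ 2 * x)))"
proof (rule summable_comparison_test')
  show "summable (\<lambda>n. exp (- x) ^ n)"
    using assms by (intro summable_geometric) simp
  fix n :: nat
  have "1 * real n \<le> pi * real (Suc n) ^ 2"
    using pi_gt3 by (intro mult_mono) (auto simp: power2_eq_square algebra_simps)
  hence "real n * x \<le> pi * real (Suc n) ^ 2 * x"
    using assms by (intro mult_right_mono) auto
  thus "norm (exp (- (pi * real (Suc n) ^ 2 * x))) \<le> exp (- x) ^ n"
    by (simp flip: exp_of_nat_mult)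
qed

lemma psi_nonneg: "x > 0 \<Longrightarrow> psi x \<ge> 0"
  unfolding psi_def by (intro suminf_nonneg summable_psi) auto

lemma psi_le:
  assumes "x \<ge> 1"
  shows "psi x \<le> exp (- x)"
proof -
  have "(\<lambda>n. exp (- x) * (1 / 2) ^ Suc n) sums (exp (- x) * 1)"
    by (intro sums_mult power_half_series)
  moreover have "exp (- (pi * real (Suc n) ^ 2 * x)) \<le> exp (- x) * (1 / 2) ^ Suc n" for n
  proof -
    \<comment> \<open>Together with \<open>pi > 3\<close> and \<open>N^2 \<ge> N\<close> this splits
      off the common factor \<open>exp (- x)\<close> and leaves a geometric series.\<close>
    have "x + N \<le> 3 * (N * x)" if "N \<ge> 1" for N :: real
    proof -
      have "1 * x \<le> N * x" "N * 1 \<le> N * x"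
        using assms that by (intro mult_right_mono mult_left_mono; simp)+
      thus ?thesis using assms by linarith
    qed
    hence "x + real (Suc n) \<le> 3 * (real (Suc n) * x)" by simp
    also have "\<dots> \<le> pi * (real (Suc n) ^ 2 * x)"
      using assms pi_gt3 by (intro mult_mono mult_right_mono) (auto simp: power2_eq_square)
    finally have "exp (- (pi * real (Suc n) ^ 2 * x)) \<le> exp (- x + - real (Suc n))"
      by (simp add: mult_ac)
    also have "\<dots> = exp (- x) * exp (- 1) ^ Suc n"
      unfolding exp_add by (simp add: exp_of_nat_mult[symmetric] del: power_Suc of_nat_Suc)
    also have "exp (- 1) ^ Suc n \<le> (1 / 2 :: real) ^ Suc n"
    proof (rule power_mono)
      have "exp (1 :: real) \<ge> 2" using exp_ge_add_one_self[of "1::real"] by simp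
      thus "exp (- 1) \<le> (1 / 2 :: real)" by (simp add: exp_minus field_simps)
    qed simp
    finally show ?thesis by simp
  qed
  ultimately show ?thesis
    unfolding psi_def using assms
    by (metis (no_types, lifting) less_le_trans mult.right_neutral suminf_le summable_psi sums_iff zero_less_one)
qed

lemma psi_measurable [measurable]: "psi \<in> borel_measurable borel"
  unfolding psi_def by measurable

text \<open>Theta inversion in the logarithmic variable: it rewrites the negative half-line of the
  Mellin integral in terms of the positive one.\<close>

lemma psi_exp_neg:
  "psi (exp (- y)) = exp (y / 2) * psi (exp y) + (exp (y / 2) - 1) / 2"
proof -
  have "sqrt (exp (- y)) = exp (- y / 2)"
    by (rule real_sqrt_unique) (simp_all flip: exp_double)
  moreover have "1 / exp (- y) = exp y" by (simp add: exp_minus inverse_eq_divide)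
  ultimately have "1 + 2 * psi (exp (- y)) = (1 + 2 * psi (exp y)) / exp (- y / 2)"
    using theta_inversion[of "exp (- y)"] by simp
  also have "\<dots> = (1 + 2 * psi (exp y)) * exp (y / 2)"
    by (simp add: exp_minus field_simps)
  finally show ?thesis by (simp add: field_simps)
qed

text \<open>With \<open>x = exp y\<close> and \<open>s = 1/2 + v\<close>, the Mellin weight
  \<open>x^(s/2) dx / x\<close> becomes \<open>exp (v * y / 2) * exp (y / 4) dy\<close>. The
  indicator reflects that the negative half-line is folded onto the positive one.\<close>

definition xi_kernel :: "real \<Rightarrow> real" where
  "xi_kernel y = indicator {0..} y * exp (y / 4) * psi (exp y)"

lemma xi_kernel_measurable [measurable]: "xi_kernel \<in> borel_measurable borel"
  unfolding xi_kernel_def by measurable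

lemma xi_kernel_nonneg: "xi_kernel y \<ge> 0"
  by (auto simp: xi_kernel_def psi_nonneg)

lemma xi_kernel_le: "xi_kernel y \<le> indicator {0..} y * exp (y / 4 - exp y)"
proof (cases "y \<ge> 0")
  case True
  have "psi (exp y) \<le> exp (- exp y)" using True by (intro psi_le) simp
  hence "exp (y / 4) * psi (exp y) \<le> exp (y / 4) * exp (- exp y)" by (intro mult_left_mono) auto
  thus ?thesis using True by (simp add: xi_kernel_def flip: exp_add)
qed (auto simp: xi_kernel_def)

lemma integrable_exp_minus:
  fixes a :: real
  assumes "a > 0"
  shows "integrable lborel (\<lambda>y. indicator {0..} y * exp (- a * y))"
    "(\<integral>y. indicator {0..} y * exp (- a * y) \<partial>lborel) = 1 / a"
proof -
  have I: "((\<lambda>y. exp (- a * y)) has_integral 1 / a) {0..}"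
    using has_integral_exp_minus_to_infinity[OF assms, of 0] by simp
  hence "(\<lambda>y. exp (- a * y)) absolutely_integrable_on {0..}"
    by (intro nonnegative_absolutely_integrable_1) auto
  hence "integrable lebesgue (\<lambda>y. indicator {0..} y * exp (- a * y))"
    by (simp add: set_integrable_def)
  thus J: "integrable lborel (\<lambda>y. indicator {0..} y * exp (- a * y))"
    by (subst (asm) integrable_completion) auto
  hence "set_integrable lborel {0..} (\<lambda>y. exp (- a * y))"
    by (simp add: set_integrable_def)
  from set_borel_integral_eq_integral(2)[OF this] I
  show "(\<integral>y. indicator {0..} y * exp (- a * y) \<partial>lborel) = 1 / a"
    by (simp add: set_lebesgue_integral_def integral_unique)
qed

lemma integrable_gaussian_xi_kernel:
  assumes "b \<ge> 0"
  shows "integrable lborel (\<lambda>y. exp (b * y ^ 2) * xi_kernel y)"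
proof -
  \<comment> \<open>The additional summand \<open>y\<close> in the exponent reserves a factor
    \<open>exp (- y)\<close>, which serves as integrable majorant once \<open>f\<close> is
    bounded.\<close>
  define f where "f = (\<lambda>y::real. exp (b * y ^ 2 + y / 4 - exp y + y))"
  have "(f \<longlongrightarrow> 0) at_top"
  proof -
    have "filterlim (\<lambda>y::real. b * y ^ 2 + y / 4 - exp y + y) at_bot at_top"
      by real_asymp
    thus ?thesis unfolding f_def by (rule filterlim_compose[OF exp_at_bot])
  qed
  hence "eventually (\<lambda>y. f y < 1) at_top" by (rule order_tendstoD) simp
  then obtain Y where Y: "\<And>y. y \<ge> Y \<Longrightarrow> f y < 1" by (auto simp: eventually_at_top_linorder)
  have "compact (f ` {0..Y})"
    by (intro compact_continuous_image) (auto simp: f_def intro!: continuous_intros)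
  then obtain B where B: "\<And>y. y \<in> {0..Y} \<Longrightarrow> f y \<le> B"
    by (auto dest!: compact_imp_bounded simp: bounded_iff) (metis abs_le_D1 atLeastAtMost_iff)
  define C where "C = max 1 B"
  have C: "f y \<le> C" if "y \<ge> 0" for y
    using Y[of y] B[of y] that by (cases "y \<ge> Y") (auto simp: C_def)
  show ?thesis
  proof (rule Bochner_Integration.integrable_bound)
    show "integrable lborel (\<lambda>y. C * (indicator {0..} y * exp (- 1 * y)))"
      by (intro integrable_mult_right integrable_exp_minus) simp
    show "AE y in lborel. norm (exp (b * y ^ 2) * xi_kernel y) \<le> norm (C * (indicator {0..} y * exp (- 1 * y)))"
    proof (intro AE_I2)
      fix y :: real
      have "norm (exp (b * y ^ 2) * xi_kernel y) \<le> exp (b * y ^ 2) * (indicator {0..} y * exp (y / 4 - exp y))"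
        using xi_kernel_le[of y] xi_kernel_nonneg[of y] by (simp add: abs_mult)
      also have "\<dots> = indicator {0..} y * (f y * exp (- y))"
        by (simp add: f_def algebra_simps flip: exp_add)
      also have "\<dots> \<le> indicator {0..} y * (C * exp (- y))"
        using C[of y] by (auto simp: indicator_def intro!: mult_right_mono)
      also have "\<dots> \<le> norm (C * (indicator {0..} y * exp (- 1 * y)))"
        by (simp add: C_def abs_mult indicator_def)
      finally show "norm (exp (b * y ^ 2) * xi_kernel y) \<le> norm (C * (indicator {0..} y * exp (- 1 * y)))" .
    qed
  qed measurable
qed

text \<open>Completing the square. With \<open>r = norm v\<close> and \<open>u = v^2\<close> it
  trades the exponential for \<open>exp (\<epsilon> * norm u)\<close> times a Gaussian that
  \<open>xi_kernel\<close> can absorb; hence the arbitrarily small exponential type of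
  \<open>xi_series\<close>.\<close>

lemma exp_linear_le_gaussian:
  fixes r y \<epsilon> :: real
  assumes "\<epsilon> > 0"
  shows "exp (r * y / 2) \<le> exp (\<epsilon> * r ^ 2) * exp (1 / (16 * \<epsilon>) * y ^ 2)"
proof -
  have "0 \<le> (4 * \<epsilon> * r - y) ^ 2 / (16 * \<epsilon>)" using assms by simp
  also have "\<dots> = \<epsilon> * r ^ 2 + 1 / (16 * \<epsilon>) * y ^ 2 - r * y / 2"
    using assms by (simp add: power2_eq_square field_simps)
  finally show ?thesis by (simp flip: exp_add)
qed

lemma integrable_exp_xi_kernel:
  "integrable lborel (\<lambda>y. exp (r * y / 2) * xi_kernel y)"
proof (rule Bochner_Integration.integrable_bound)
  show "integrable lborel (\<lambda>y. exp (1 * r ^ 2) * (exp (1 / (16 * 1) * y ^ 2) * xi_kernel y))"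
    by (intro integrable_mult_right integrable_gaussian_xi_kernel) simp
  show "AE y in lborel. norm (exp (r * y / 2) * xi_kernel y) \<le> norm (exp (1 * r ^ 2) * (exp (1 / (16 * 1) * y ^ 2) * xi_kernel y))"
    using exp_linear_le_gaussian[of 1 r] xi_kernel_nonneg
    by (intro AE_I2) (auto simp: abs_mult mult.assoc[symmetric] intro!: mult_right_mono)
qed measurable

text \<open>
  \<open>xi_series u\<close> is \<open>\<integral> 2 cosh (v y / 2) xi_kernel y dy\<close> with \<open>u = v\<^sup>2\<close>, expanded in powers of \<open>u\<close>: this
  yields an entire function of \<open>u\<close> without a choice of the square root.
\<close>
definition xi_coeff :: "nat \<Rightarrow> real" where
  "xi_coeff k = (\<integral>y. 2 * (y / 2) ^ (2 * k) / fact (2 * k) * xi_kernel y \<partial>lborel)"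

definition xi_series :: "complex \<Rightarrow> complex" where
  "xi_series u = (\<Sum>k. of_real (xi_coeff k) * u ^ k)"

lemma cosh_even_series:
  fixes x :: "'a :: {banach, real_normed_field}"
  shows "(\<lambda>k. x ^ (2 * k) / fact (2 * k)) sums cosh x"
proof -
  have "(\<lambda>k. (\<lambda>n. if even n then x ^ n /\<^sub>R fact n else 0) (2 * k)) sums cosh x"
    by (subst sums_mono_reindex) (auto simp: strict_mono_def cosh_converges elim: evenE)
  thus ?thesis by (simp add: scaleR_conv_of_real field_simps)
qed

text \<open>Termwise integration of the even series of \<open>cosh\<close>. The sum of the norms is
  the same integrand at the real argument \<open>norm v\<close>, whose integrability provides
  domination and summability at once.\<close>

lemma xi_series_cosh_integral:
  fixes v :: complex
  defines "f \<equiv> (\<lambda>k y. of_real (2 * (y / 2) ^ (2 * k) / fact (2 * k) * xi_kernel y) * v ^ (2 * k))"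
  shows "(\<lambda>k. of_real (xi_coeff k) * (v ^ 2) ^ k) sums (\<integral>y. 2 * cosh (v * of_real y / 2) * of_real (xi_kernel y) \<partial>lborel)"
    and "integrable lborel (\<lambda>y. 2 * cosh (v * of_real y / 2) * of_real (xi_kernel y))"
proof -
  have norm_f: "norm (f k y) = 2 * ((norm v * y / 2) ^ (2 * k) / fact (2 * k)) * xi_kernel y" for k y
    using xi_kernel_nonneg[of y]
    by (simp add: f_def norm_mult norm_power norm_divide abs_mult power_mult_distrib power_divide power_even_abs)
  have norm_sums: "(\<lambda>k. norm (f k y)) sums (2 * cosh (norm v * y / 2) * xi_kernel y)" for y
    unfolding norm_f by (intro sums_mult sums_mult2 cosh_even_series)
  have f_sums: "(\<lambda>k. f k y) sums (2 * cosh (v * of_real y / 2) * of_real (xi_kernel y))" for y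
  proof -
    have "f k y = 2 * ((v * of_real y / 2) ^ (2 * k) / fact (2 * k)) * of_real (xi_kernel y)" for k
      by (simp add: f_def power_mult_distrib power_divide)
    thus ?thesis by (simp only:) (intro sums_mult sums_mult2 cosh_even_series)
  qed
  have int_cosh: "integrable lborel (\<lambda>y. 2 * cosh (norm v * y / 2) * xi_kernel y)"
  proof -
    have "integrable lborel (\<lambda>y. exp (norm v * y / 2) * xi_kernel y + exp (- norm v * y / 2) * xi_kernel y)"
      by (intro Bochner_Integration.integrable_add integrable_exp_xi_kernel)
    thus ?thesis by (simp add: cosh_def algebra_simps)
  qed
  have f_meas [measurable]: "f k \<in> borel_measurable lborel" for k
    unfolding f_def by measurable
  have nsum_le: "(\<Sum>k<n. norm (f k y)) \<le> 2 * cosh (norm v * y / 2) * xi_kernel y" for n y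
    using sum_le_suminf[OF sums_summable[OF norm_sums[of y]], of "{..<n}"] sums_unique[OF norm_sums[of y]] by simp
  have int_f: "integrable lborel (f k)" for k
  proof (rule Bochner_Integration.integrable_bound[OF int_cosh])
    show "AE y in lborel. norm (f k y) \<le> norm (2 * cosh (norm v * y / 2) * xi_kernel y)"
    proof (intro AE_I2)
      fix y :: real
      have "norm (f k y) \<le> (\<Sum>k<Suc k. norm (f k y))" by (simp add: sum_nonneg)
      also note nsum_le
      finally show "norm (f k y) \<le> norm (2 * cosh (norm v * y / 2) * xi_kernel y)" by simp
    qed
  qed measurable
  have summ: "summable (\<lambda>k. \<integral>y. norm (f k y) \<partial>lborel)"
  proof (rule summableI_nonneg_bounded)
    fix n
    have "(\<Sum>k<n. \<integral>y. norm (f k y) \<partial>lborel) = (\<integral>y. (\<Sum>k<n. norm (f k y)) \<partial>lborel)"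
      by (subst Bochner_Integration.integral_sum) (auto intro: int_f)
    also have "\<dots> \<le> (\<integral>y. 2 * cosh (norm v * y / 2) * xi_kernel y \<partial>lborel)"
      using nsum_le by (intro integral_mono Bochner_Integration.integrable_sum integrable_norm int_f int_cosh) auto
    finally show "(\<Sum>k<n. \<integral>y. norm (f k y) \<partial>lborel) \<le> (\<integral>y. 2 * cosh (norm v * y / 2) * xi_kernel y \<partial>lborel)" .
  qed auto
  have AE: "AE y in lborel. summable (\<lambda>k. norm (f k y))"
    using norm_sums by (intro AE_I2) (auto simp: sums_iff)
  have "(\<lambda>k. \<integral>y. f k y \<partial>lborel) sums (\<integral>y. (\<Sum>k. f k y) \<partial>lborel)"
    by (rule sums_integral[OF int_f AE summ])
  moreover have "(\<integral>y. f k y \<partial>lborel) = of_real (xi_coeff k) * (v ^ 2) ^ k" for k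
    unfolding f_def xi_coeff_def by (simp only: integral_mult_left_zero integral_complex_of_real power_mult)
  moreover have sum_eq: "(\<lambda>y. \<Sum>k. f k y) = (\<lambda>y. 2 * cosh (v * of_real y / 2) * of_real (xi_kernel y))"
    using f_sums by (simp add: sums_iff)
  ultimately show "(\<lambda>k. of_real (xi_coeff k) * (v ^ 2) ^ k) sums (\<integral>y. 2 * cosh (v * of_real y / 2) * of_real (xi_kernel y) \<partial>lborel)"
    by simp
  show "integrable lborel (\<lambda>y. 2 * cosh (v * of_real y / 2) * of_real (xi_kernel y))"
    using integrable_suminf[OF int_f AE summ] sum_eq by simp
qed

lemma xi_series_square:
  "xi_series (v ^ 2) = (\<integral>y. 2 * cosh (v * of_real y / 2) * of_real (xi_kernel y) \<partial>lborel)"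
  unfolding xi_series_def by (rule sums_unique[OF xi_series_cosh_integral(1), symmetric])

lemma xi_series_sums: "(\<lambda>k. of_real (xi_coeff k) * u ^ k) sums xi_series u"
  using xi_series_cosh_integral(1)[of "csqrt u"] unfolding xi_series_square[symmetric] power2_csqrt .

lemma xi_series_holomorphic: "xi_series holomorphic_on A"
proof (rule holomorphic_on_subset)
  show "xi_series holomorphic_on UNIV"
  proof -
    have "(\<lambda>k. of_real (xi_coeff k) * (w - 0) ^ k) sums xi_series w" for w
      using xi_series_sums[of w] by simp
    hence "xi_series holomorphic_on ball 0 r" for r
      by (rule power_series_holomorphic)
    hence "xi_series analytic_on {z}" for z
      by (intro holomorphic_on_imp_analytic_at[of _ "ball 0 (norm z + 1)"]) auto
    hence "xi_series analytic_on UNIV"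
      using analytic_on_analytic_at by blast
    thus ?thesis
      by (rule analytic_imp_holomorphic)
  qed
qed auto

lemma norm_cosh_le: "norm (cosh z) \<le> exp (norm z)" for z :: complex
proof -
  have "norm (cosh z) = norm (exp z + exp (- z)) / 2"
    by (simp add: cosh_def norm_divide)
  also have "norm (exp z + exp (- z)) \<le> exp (norm z) + exp (norm z)"
    using norm_triangle_ineq[of "exp z" "exp (- z)"] norm_exp[of z] norm_exp[of "- z"]
    unfolding norm_minus_cancel by linarith
  finally show ?thesis by simp
qed

lemma xi_series_bound:
  assumes "\<epsilon> > 0"
  shows "\<exists>C. \<forall>u. norm (xi_series u) \<le> C * exp (\<epsilon> * norm u)"
proof (intro exI allI)
  fix u :: complex
  define v where "v = csqrt u"
  have v: "v ^ 2 = u" by (simp add: v_def)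
  have nv: "norm v ^ 2 = norm u" by (simp flip: v norm_power)
  have "norm (xi_series u) \<le> (\<integral>y. 2 * exp (\<epsilon> * norm u) * (exp (1 / (16 * \<epsilon>) * y ^ 2) * xi_kernel y) \<partial>lborel)"
    unfolding v[symmetric] xi_series_square
  proof (rule Bochner_Integration.integral_norm_bound_integral)
    show "integrable lborel (\<lambda>y. 2 * cosh (v * of_real y / 2) * of_real (xi_kernel y))"
      by (rule xi_series_cosh_integral)
    show "integrable lborel (\<lambda>y. 2 * exp (\<epsilon> * norm (v ^ 2)) * (exp (1 / (16 * \<epsilon>) * y ^ 2) * xi_kernel y))"
      using assms by (intro integrable_mult_right integrable_gaussian_xi_kernel) auto
    fix y :: real
    show "norm (2 * cosh (v * of_real y / 2) * of_real (xi_kernel y)) \<le>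
       2 * exp (\<epsilon> * norm (v ^ 2)) * (exp (1 / (16 * \<epsilon>) * y ^ 2) * xi_kernel y)"
    proof (cases "y \<ge> 0")
      case True
      have "norm (cosh (v * of_real y / 2)) \<le> exp (norm v * y / 2)"
        using norm_cosh_le[of "v * of_real y / 2"] True by (simp add: norm_mult norm_divide)
      also have "\<dots> \<le> exp (\<epsilon> * norm v ^ 2) * exp (1 / (16 * \<epsilon>) * y ^ 2)"
        by (rule exp_linear_le_gaussian[OF assms])
      finally have "norm (cosh (v * of_real y / 2)) \<le> exp (\<epsilon> * norm (v ^ 2)) * exp (1 / (16 * \<epsilon>) * y ^ 2)"
        by (simp add: norm_power)
      from mult_right_mono[OF this xi_kernel_nonneg[of y]] show ?thesis
        using xi_kernel_nonneg[of y] by (simp add: norm_mult mult_ac)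
    qed (auto simp: xi_kernel_def)
  qed
  also have "\<dots> = (2 * (\<integral>y. exp (1 / (16 * \<epsilon>) * y ^ 2) * xi_kernel y \<partial>lborel)) * exp (\<epsilon> * norm u)"
    by (subst integral_mult_right_zero) simp
  finally show "norm (xi_series u) \<le> (2 * (\<integral>y. exp (1 / (16 * \<epsilon>) * y ^ 2) * xi_kernel y \<partial>lborel)) * exp (\<epsilon> * norm u)" .
qed

text \<open>The bound 4 is the value that \<open>xi_series 0\<close> would take if
  \<open>zeta (1/2)\<close> vanished. The estimate \<open>exp y \<ge> 1 + y\<close> already yields
  \<open>8/3\<close>.\<close>

lemma norm_xi_series_0: "norm (xi_series 0) < 4"
proof -
  have "norm (xi_series (0 ^ 2)) \<le> (\<integral>y. 2 * (indicator {0..} y * exp (- (3 / 4) * y)) \<partial>(lborel :: real measure))"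
    unfolding xi_series_square
  proof (rule Bochner_Integration.integral_norm_bound_integral)
    show "integrable lborel (\<lambda>y. 2 * cosh (0 * complex_of_real y / 2) * of_real (xi_kernel y))"
      by (rule xi_series_cosh_integral)
    show "integrable lborel (\<lambda>y::real. 2 * (indicator {0..} y * exp (- (3 / 4) * y)))"
      by (intro integrable_mult_right integrable_exp_minus) simp
    fix y :: real
    have "xi_kernel y \<le> indicator {0..} y * exp (y / 4 - exp y)" by (rule xi_kernel_le)
    also have "\<dots> \<le> indicator {0..} y * exp (- (3 / 4) * y)"
    proof -
      have "y / 4 - exp y \<le> - (3 / 4) * y" using exp_ge_add_one_self[of y] by linarith
      thus ?thesis by (intro mult_left_mono) auto
    qed
    finally show "norm (2 * cosh (0 * complex_of_real y / 2) * of_real (xi_kernel y)) \<le> 2 * (indicator {0..} y * exp (- (3 / 4) * y))"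
      using xi_kernel_nonneg[of y] by (simp add: norm_mult)
  qed
  also have "\<dots> = 2 * (1 / (3 / 4))"
    by (subst integral_mult_right_zero, subst integrable_exp_minus(2)) auto
  finally show ?thesis by simp
qed

section \<open>Termwise Mellin transform and Riemann's splitting of the integral\<close>

lemma gamma_integral_lborel:
  assumes "Re a > 0"
  shows "set_integrable lborel {0<..} (\<lambda>t. complex_of_real t powr (a - 1) / of_real (exp t))"
    "(LINT t:{0<..}|lborel. complex_of_real t powr (a - 1) / of_real (exp t)) = Gamma a"
proof -
  have meas: "(\<lambda>t. indicator {0<..} t *\<^sub>R (complex_of_real t powr (a - 1) / of_real (exp t))) \<in> borel_measurable borel"
    by (rule borel_measurable_continuous_on_indicator)
       (auto intro!: continuous_intros simp: complex_nonpos_Reals_iff)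
  have "integrable lebesgue (\<lambda>t. indicator {0<..} t *\<^sub>R (complex_of_real t powr (a - 1) / of_real (exp t)))"
    using absolutely_integrable_Gamma_integral'[OF assms] by (simp add: set_integrable_def)
  hence "integrable lborel (\<lambda>t. indicator {0<..} t *\<^sub>R (complex_of_real t powr (a - 1) / of_real (exp t)))"
    using meas by (subst (asm) integrable_completion) auto
  thus I: "set_integrable lborel {0<..} (\<lambda>t. complex_of_real t powr (a - 1) / of_real (exp t))"
    by (simp add: set_integrable_def)
  show "(LINT t:{0<..}|lborel. complex_of_real t powr (a - 1) / of_real (exp t)) = Gamma a"
    using set_borel_integral_eq_integral(2)[OF I] Gamma_integral_complex'[OF assms]
    by (simp add: integral_unique)
qed

text \<open>The substitution \<open>x = c * exp y\<close> in Euler's integral;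
  \<open>c = pi * n^2\<close> gives the individual terms of the theta series.\<close>

lemma gamma_integral_exp:
  fixes a :: complex and c :: real
  assumes a: "Re a > 0" and c: "c > 0"
  defines "f \<equiv> (\<lambda>y. exp (a * of_real y) * of_real (exp (- (c * exp y))))"
  shows "integrable lborel f" "(\<integral>y. f y \<partial>lborel) = Gamma a * of_real c powr (- a)"
proof -
  have eq: "(1 / x) *\<^sub>R f (ln x - ln c) = of_real c powr (- a) * (of_real x powr (a - 1) / of_real (exp x))"
    if "x > 0" for x
  proof -
    have "c * exp (ln x - ln c) = x" using that c by (simp add: exp_diff)
    moreover have "exp (a * of_real (ln x - ln c)) = of_real x powr a * of_real c powr (- a)"
      using that c by (simp add: powr_def exp_add[symmetric] algebra_simps Ln_of_real)
    moreover have "of_real x powr (a - 1) = of_real x powr a / of_real x"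
      using that by (simp add: powr_diff)
    ultimately show ?thesis
      using that by (simp add: f_def scaleR_conv_of_real exp_minus field_simps)
  qed
  have I: "set_integrable lborel {0<..} (\<lambda>x. (1 / x) *\<^sub>R f (ln x - ln c))"
  proof -
    have "set_integrable lborel {0<..} (\<lambda>x. of_real c powr (- a) * (of_real x powr (a - 1) / of_real (exp x)))"
      by (intro set_integrable_mult_right gamma_integral_lborel a)
    also have "?this \<longleftrightarrow> ?thesis"
      by (intro set_integrable_cong) (auto simp: eq)
    finally show ?thesis .
  qed
  have ev: "einterval (-\<infinity>) \<infinity> = UNIV" "einterval 0 \<infinity> = {0<..}"
    by (auto simp: einterval_def zero_ereal_def)
  have lims: "((ereal \<circ> (\<lambda>x. ln x - ln c) \<circ> real_of_ereal) \<longlongrightarrow> - \<infinity>) (at_right 0)"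
     "((ereal \<circ> (\<lambda>x. ln x - ln c) \<circ> real_of_ereal) \<longlongrightarrow> \<infinity>) (at_left \<infinity>)"
    unfolding zero_ereal_def ereal_tendsto_simps by real_asymp+
  have der: "((\<lambda>x. ln x - ln c) has_field_derivative 1 / x) (at x)" if "x > 0" for x :: real
    using that by (auto intro!: derivative_eq_intros simp: field_simps)
  have "set_integrable lborel (einterval (-\<infinity>) \<infinity>) (\<lambda>y. norm (f y))"
  \<comment> \<open>The substitution rule for complex integrands presupposes integrability on both
    sides. The rule for nonnegative functions, applied to the norm, provides it on the whole
    line.\<close>
  proof (rule interval_integral_substitution_nonneg(1)[where g = "\<lambda>x. ln x - ln c" and g' = "\<lambda>x. 1 / x" and a = 0 and b = \<infinity>])
    have "set_integrable lborel {0<..} (\<lambda>x. norm ((1 / x) *\<^sub>R f (ln x - ln c)))"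
      using I by (rule set_integrable_norm)
    also have "?this \<longleftrightarrow> set_integrable lborel {0<..} (\<lambda>x. norm (f (ln x - ln c)) * (1 / x))"
      by (intro set_integrable_cong) auto
    finally show "set_integrable lborel (einterval 0 \<infinity>) (\<lambda>x. norm (f (ln x - ln c)) * (1 / x))"
      by (simp only: ev)
    show "isCont (\<lambda>y. norm (f y)) (ln x - ln c)" if "0 < ereal x" for x
      unfolding f_def by (intro continuous_intros)
  qed (use lims der in \<open>auto simp: zero_ereal_def intro!: continuous_intros\<close>)
  hence N: "integrable lborel (\<lambda>y. norm (f y))" by (simp add: ev set_integrable_def)
  have "f \<in> borel_measurable borel"
    unfolding f_def by (intro borel_measurable_continuous_onI continuous_intros)
  hence "f \<in> borel_measurable lborel" by simp
  with N show int: "integrable lborel f" by (rule integrable_norm_cancel)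
  have "(LBINT y=-\<infinity>..\<infinity>. f y) = (LBINT x=0..\<infinity>. (1 / x) *\<^sub>R f (ln x - ln c))"
  proof (rule interval_integral_substitution_integrable)
    show "set_integrable lborel (einterval 0 \<infinity>) (\<lambda>x. (1 / x) *\<^sub>R f (ln x - ln c))"
      unfolding ev by (rule I)
    show "set_integrable lborel (einterval (-\<infinity>) \<infinity>) f"
      using int by (simp add: ev set_integrable_def)
    show "isCont f (ln x - ln c)" if "0 < ereal x" for x
      unfolding f_def by (intro continuous_intros)
  qed (use lims der in \<open>auto simp: zero_ereal_def intro!: continuous_intros\<close>)
  also have "\<dots> = (LINT x:{0<..}|lborel. (1 / x) *\<^sub>R f (ln x - ln c))"
    by (simp add: interval_lebesgue_integral_def ev)
  also have "\<dots> = (LINT x:{0<..}|lborel. of_real c powr (- a) * (of_real x powr (a - 1) / of_real (exp x)))"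
    by (intro set_lebesgue_integral_cong) (auto simp: eq)
  also have "\<dots> = of_real c powr (- a) * Gamma a"
    by (simp only: set_integral_mult_right gamma_integral_lborel(2)[OF a])
  finally show "(\<integral>y. f y \<partial>lborel) = Gamma a * of_real c powr (- a)"
    by (simp add: interval_lebesgue_integral_def ev set_lebesgue_integral_def mult.commute)
qed

lemma integral_exp_complex:
  fixes a :: complex
  assumes "Re a > 0"
  shows "integrable lborel (\<lambda>y. indicator {0..} y *\<^sub>R exp (- a * of_real y))"
    "(\<integral>y. indicator {0..} y *\<^sub>R exp (- a * of_real y) \<partial>lborel) = 1 / a"
proof -
  have a0: "a \<noteq> 0" using assms by auto
  show int: "integrable lborel (\<lambda>y. indicator {0..} y *\<^sub>R exp (- a * of_real y))"
  proof (rule Bochner_Integration.integrable_bound[OF integrable_exp_minus(1)[OF assms]])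
    show "(\<lambda>y. indicator {0..} y *\<^sub>R exp (- a * of_real y)) \<in> borel_measurable lborel"
    proof -
      have "(\<lambda>y. indicator {0..} y *\<^sub>R exp (- a * of_real y)) \<in> borel_measurable borel"
        by (rule borel_measurable_continuous_on_indicator) (auto intro!: continuous_intros)
      thus ?thesis by simp
    qed
  qed (auto simp: indicator_def)
  have ev: "einterval 0 \<infinity> = {0<..}" by (auto simp: einterval_def zero_ereal_def)
  have int': "set_integrable lborel {0<..} (\<lambda>y. exp (- a * of_real y))"
    by (rule set_integrable_subset[of _ "{0..}"]) (use int in \<open>auto simp: set_integrable_def\<close>)
  have "(LBINT y=0..\<infinity>. exp (- a * of_real y)) = 0 - (- 1 / a)"
  proof (rule interval_integral_FTC_integrable[where F = "\<lambda>y. - exp (- a * of_real y) / a"])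
    show "((\<lambda>y. - exp (- a * of_real y) / a) has_vector_derivative exp (- a * of_real x)) (at x)" for x :: real
      using a0 by (auto intro!: derivative_eq_intros has_vector_derivative_real_field)
    show "(((\<lambda>y. - exp (- a * of_real y) / a) \<circ> real_of_ereal) \<longlongrightarrow> - 1 / a) (at_right 0)"
      unfolding zero_ereal_def ereal_tendsto_simps using a0 by (auto intro!: tendsto_eq_intros)
    show "(((\<lambda>y. - exp (- a * of_real y) / a) \<circ> real_of_ereal) \<longlongrightarrow> 0) (at_left \<infinity>)"
      unfolding ereal_tendsto_simps
    proof (rule tendsto_norm_zero_cancel)
      have "((\<lambda>y. exp (- r * y) / n) \<longlongrightarrow> 0) at_top" if "r > 0" "n > 0" for r n :: real
        using that by real_asymp
      from this[of "Re a" "norm a"] have "((\<lambda>y. exp (- Re a * y) / norm a) \<longlongrightarrow> 0) at_top"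
        using assms a0 by simp
      thus "((\<lambda>y. norm (- exp (- a * of_real y) / a)) \<longlongrightarrow> 0) at_top"
        by (simp add: norm_divide)
    qed
  qed (use int' in \<open>auto simp: ev intro!: continuous_intros\<close>)
  hence "(LINT y:{0<..}|lborel. exp (- a * of_real y)) = 1 / a"
    by (simp add: interval_lebesgue_integral_def ev)
  moreover have "(\<integral>y. indicator {0..} y *\<^sub>R exp (- a * of_real y) \<partial>lborel) = (LINT y:{0<..}|lborel. exp (- a * of_real y))"
    unfolding set_lebesgue_integral_def
  proof (rule integral_cong_AE)
    show "AE y in lborel. indicator {0..} y *\<^sub>R exp (- a * of_real y) = indicator {0<..} y *\<^sub>R exp (- a * of_real y)"
      using AE_lborel_singleton[of 0] by eventually_elim (auto simp: indicator_def)
  qed (use int int' in \<open>auto simp: set_integrable_def\<close>)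
  ultimately show "(\<integral>y. indicator {0..} y *\<^sub>R exp (- a * of_real y) \<partial>lborel) = 1 / a"
    by simp
qed

lemma mellin_psi:
  assumes s: "Re s > 1"
  shows "integrable lborel (\<lambda>y. exp (s / 2 * of_real y) * of_real (psi (exp y)))" (is "integrable _ ?f")
    "(\<lambda>n. Gamma (s / 2) * of_real pi powr (- s / 2) * (1 / of_nat (Suc n) powr s)) sums
       (\<integral>y. exp (s / 2 * of_real y) * of_real (psi (exp y)) \<partial>lborel)"
proof -
  define a where "a = s / 2"
  have a: "Re a > 1 / 2" using s by (simp add: a_def)
  define f where "f = (\<lambda>n y. exp (a * of_real y) * of_real (exp (- (pi * real (Suc n) ^ 2 * exp y))))"
  have int: "integrable lborel (f n)" for n
    unfolding f_def using a by (intro gamma_integral_exp) auto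
  have pw: "of_real (pi * real (Suc n) ^ 2) powr (- b) = of_real pi powr (- b) * (1 / of_nat (Suc n) powr (2 * b))"
    for n and b :: complex
  proof -
    have "of_real (pi * real (Suc n) ^ 2) powr (- b) = exp (- b * of_real (ln pi + 2 * ln (real (Suc n))))"
      by (simp add: powr_def Ln_of_real ln_mult ln_realpow del: of_real_mult of_real_power of_nat_Suc)
    also have "\<dots> = exp (- b * of_real (ln pi)) * exp (- (2 * b * of_real (ln (real (Suc n)))))"
      by (simp add: exp_add[symmetric] algebra_simps)
    also have "exp (- b * of_real (ln pi)) = of_real pi powr (- b)"
      by (simp add: powr_def Ln_of_real)
    also have "exp (- (2 * b * of_real (ln (real (Suc n))))) = 1 / of_nat (Suc n) powr (2 * b)"
      using Ln_of_real[of "real (Suc n)"] by (simp add: powr_def exp_minus inverse_eq_divide del: of_nat_Suc)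
    finally show ?thesis .
  qed
  have int_val: "(\<integral>y. f n y \<partial>lborel) = Gamma a * of_real pi powr (- a) * (1 / of_nat (Suc n) powr (2 * a))" for n
    unfolding f_def using a by (subst gamma_integral_exp) (auto simp: pw simp del: of_nat_Suc of_real_mult)
  have norm_f: "norm (f n y) = exp (Re a * y) * exp (- (pi * real (Suc n) ^ 2 * exp y))" for n y
    by (simp add: f_def norm_mult)
  have AE: "AE y in lborel. summable (\<lambda>n. norm (f n y))"
    unfolding norm_f by (intro AE_I2 summable_mult summable_psi) auto
  have summ: "summable (\<lambda>n. \<integral>y. norm (f n y) \<partial>lborel)"
  proof -
    \<comment> \<open>The norms are integrands of the same kind at the real point
      \<open>Re a\<close>, so their integrals are a constant times \<open>(n + 1)\<close> to the
      power \<open>- Re s\<close>; here \<open>Re s > 1\<close> enters.\<close>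
    define b where "b = complex_of_real (Re a)"
    have "(\<integral>y. norm (f n y) \<partial>lborel) = norm (Gamma b * of_real pi powr (- b)) * (1 / real (Suc n) powr (2 * Re a))" for n
    proof -
      have "complex_of_real (\<integral>y. norm (f n y) \<partial>lborel) =
          (\<integral>y. exp (b * of_real y) * of_real (exp (- (pi * real (Suc n) ^ 2 * exp y))) \<partial>lborel)"
        unfolding norm_f integral_complex_of_real[symmetric]
        by (simp add: b_def exp_of_real[symmetric])
      also have "\<dots> = Gamma b * of_real pi powr (- b) * (1 / of_nat (Suc n) powr (2 * b))"
        using a by (subst gamma_integral_exp) (auto simp: b_def pw simp del: of_nat_Suc of_real_mult)
      finally have "norm (complex_of_real (\<integral>y. norm (f n y) \<partial>lborel)) = norm (Gamma b * of_real pi powr (- b)) * (1 / norm (of_nat (Suc n) powr (2 * b)))"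
        by (simp add: norm_mult norm_divide del: of_nat_Suc)
      moreover have "norm (complex_of_nat (Suc n) powr (2 * b)) = real (Suc n) powr (2 * Re a)"
        using norm_powr_real_powr[of "complex_of_nat (Suc n)" "2 * b"] by (simp add: b_def del: of_nat_Suc)
      ultimately show ?thesis by (simp del: of_nat_Suc)
    qed
    moreover have "summable (\<lambda>n. real (Suc n) powr (- (2 * Re a)))"
      using a by (subst summable_Suc_iff) (simp add: summable_real_powr_iff)
    ultimately show ?thesis
      by (simp only: powr_minus_divide) (intro summable_mult, simp)
  qed
  have sum_eq: "(\<Sum>n. f n y) = exp (s / 2 * of_real y) * of_real (psi (exp y))" for y
  proof -
    have "(\<lambda>n. of_real (exp (- (pi * real (Suc n) ^ 2 * exp y))) :: complex) sums of_real (psi (exp y))"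
      unfolding psi_def by (intro sums_of_real summable_sums summable_psi) auto
    from sums_mult[OF this, of "exp (a * of_real y)"] show ?thesis
      by (simp add: f_def a_def sums_iff)
  qed
  show "integrable lborel ?f"
    using integrable_suminf[OF int AE summ] by (simp only: sum_eq)
  have "(\<lambda>n. \<integral>y. f n y \<partial>lborel) sums (\<integral>y. (\<Sum>n. f n y) \<partial>lborel)"
    by (rule sums_integral[OF int AE summ])
  thus "(\<lambda>n. Gamma (s / 2) * of_real pi powr (- s / 2) * (1 / of_nat (Suc n) powr s)) sums (\<integral>y. ?f y \<partial>lborel)"
    by (simp only: int_val sum_eq) (simp add: a_def)
qed

text \<open>Riemann's argument: the negative half-line is reflected by theta inversion. Its
  \<open>psi\<close> part joins the positive half to form the \<open>cosh\<close> integral with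
  \<open>v = s - 1/2\<close>; the elementary part \<open>(exp (y / 2) - 1) / 2\<close> integrates to
  \<open>(2 / (s - 1) - 2 / s) / 2\<close>, the polar term.\<close>

lemma mellin_psi_xi_series:
  assumes s: "Re s > 1"
  shows "(\<integral>y. exp (s / 2 * of_real y) * of_real (psi (exp y)) \<partial>lborel) = 1 / (s * (s - 1)) + xi_series ((s - 1 / 2) ^ 2)"
proof -
  define f where "f = (\<lambda>y. exp (s / 2 * of_real y) * complex_of_real (psi (exp y)))"
  define I where "I = (\<lambda>y::real. indicator {0..} y :: real)"
  have int: "integrable lborel f" unfolding f_def by (rule mellin_psi(1)[OF s])
  have int_pos: "integrable lborel (\<lambda>y. I y *\<^sub>R f y)"
    unfolding I_def using int by (intro integrable_mult_indicator) auto
  have int_refl: "integrable lborel (\<lambda>y. f (- y))"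
    using lborel_integrable_real_affine[OF int, of "-1" 0] by simp
  have int_neg: "integrable lborel (\<lambda>y. I y *\<^sub>R f (- y))"
    unfolding I_def using int_refl by (intro integrable_mult_indicator) auto
  have "(\<integral>y. f y \<partial>lborel) = (\<integral>y. I y *\<^sub>R f y + I (- y) *\<^sub>R f y \<partial>lborel)"
  proof (rule integral_cong_AE)
    show "AE y in lborel. f y = I y *\<^sub>R f y + I (- y) *\<^sub>R f y"
      using AE_lborel_singleton[of 0] by eventually_elim (auto simp: I_def indicator_def)
    have [measurable]: "f \<in> borel_measurable lborel" using int by auto
    show "(\<lambda>y. I y *\<^sub>R f y + I (- y) *\<^sub>R f y) \<in> borel_measurable lborel"
      unfolding I_def by measurable
  qed (use int in auto)
  also have "\<dots> = (\<integral>y. I y *\<^sub>R f y \<partial>lborel) + (\<integral>y. I (- y) *\<^sub>R f y \<partial>lborel)"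
    using int_pos lborel_integrable_real_affine[OF int_neg, of "-1" 0]
    by (intro Bochner_Integration.integral_add) auto
  also have "(\<integral>y. I (- y) *\<^sub>R f y \<partial>lborel) = (\<integral>y. I y *\<^sub>R f (- y) \<partial>lborel)"
    using lborel_integral_real_affine[of "-1" "\<lambda>y. I (- y) *\<^sub>R f y" 0] by simp
  also have "(\<lambda>y. I y *\<^sub>R f (- y)) = (\<lambda>y. I y *\<^sub>R (exp ((1 - s) / 2 * of_real y) * of_real (psi (exp y))) +
      (I y *\<^sub>R exp (- ((s - 1) / 2) * of_real y) - I y *\<^sub>R exp (- (s / 2) * of_real y)) / 2)"
  proof
    fix y :: real
    have e: "exp ((1 - s) / 2 * of_real y) = exp (- (s / 2) * of_real y) * of_real (exp (y / 2))"
      by (simp add: exp_of_real[symmetric] exp_add[symmetric] field_simps)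
    have "- ((s - 1) / 2) * of_real y = (1 - s) / 2 * of_real y" by (simp add: field_simps)
    hence e': "exp (- ((s - 1) / 2) * of_real y) = exp (- (s / 2) * of_real y) * of_real (exp (y / 2))"
      using e by (simp only:)
    show "I y *\<^sub>R f (- y) = I y *\<^sub>R (exp ((1 - s) / 2 * of_real y) * of_real (psi (exp y))) +
      (I y *\<^sub>R exp (- ((s - 1) / 2) * of_real y) - I y *\<^sub>R exp (- (s / 2) * of_real y)) / 2"
      unfolding e e' f_def psi_exp_neg by (simp add: scaleR_conv_of_real field_simps)
  qed
  also have "(\<integral>y. I y *\<^sub>R f y \<partial>lborel) + (\<integral>y. I y *\<^sub>R (exp ((1 - s) / 2 * of_real y) * of_real (psi (exp y))) +
      (I y *\<^sub>R exp (- ((s - 1) / 2) * of_real y) - I y *\<^sub>R exp (- (s / 2) * of_real y)) / 2 \<partial>lborel) =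
     (\<integral>y. 2 * cosh ((s - 1 / 2) * of_real y / 2) * of_real (xi_kernel y) \<partial>lborel) +
     (1 / ((s - 1) / 2) - 1 / (s / 2)) / 2"
  proof -
    define g where "g = (\<lambda>y. I y *\<^sub>R (exp ((1 - s) / 2 * of_real y) * complex_of_real (psi (exp y))))"
    define h where "h = (\<lambda>y. (I y *\<^sub>R exp (- ((s - 1) / 2) * complex_of_real y) - I y *\<^sub>R exp (- (s / 2) * of_real y)) / 2)"
    have sum: "I y *\<^sub>R f y + g y = 2 * cosh ((s - 1 / 2) * of_real y / 2) * of_real (xi_kernel y)" for y
    proof -
      have e1: "exp ((s - 1 / 2) * of_real y / 2) * of_real (exp (y / 4)) = exp (s / 2 * of_real y)"
        by (simp add: exp_of_real[symmetric] exp_add[symmetric] field_simps)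
      have e2: "exp (- ((s - 1 / 2) * of_real y / 2)) * of_real (exp (y / 4)) = exp ((1 - s) / 2 * of_real y)"
      proof -
        have "- ((s - 1 / 2) * of_real y / 2) + of_real (y / 4) = (1 - s) / 2 * of_real y"
          by (simp add: field_simps)
        thus ?thesis by (simp only: exp_of_real[symmetric] exp_add[symmetric])
      qed
      show ?thesis
        unfolding g_def f_def xi_kernel_def I_def e1[symmetric] e2[symmetric]
        by (simp add: cosh_def scaleR_conv_of_real algebra_simps)
    qed
    have int_sum: "integrable lborel (\<lambda>y. I y *\<^sub>R f y + g y)"
      unfolding sum by (rule xi_series_cosh_integral)
    hence int_g: "integrable lborel g"
      using Bochner_Integration.integrable_diff[OF int_sum int_pos] by simp
    have int_h: "integrable lborel h" "(\<integral>y. h y \<partial>lborel) = (1 / ((s - 1) / 2) - 1 / (s / 2)) / 2"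
    proof -
      have r: "Re ((s - 1) / 2) > 0" "Re (s / 2) > 0" using s by auto
      note e1 = integral_exp_complex[OF r(1), folded I_def] and e2 = integral_exp_complex[OF r(2), folded I_def]
      show "integrable lborel h"
        unfolding h_def by (intro integrable_divide_zero Bochner_Integration.integrable_diff e1 e2)
      show "(\<integral>y. h y \<partial>lborel) = (1 / ((s - 1) / 2) - 1 / (s / 2)) / 2"
        unfolding h_def integral_divide_zero Bochner_Integration.integral_diff[OF e1(1) e2(1)] e1(2) e2(2) ..
    qed
    have "(\<lambda>y. I y *\<^sub>R (exp ((1 - s) / 2 * of_real y) * complex_of_real (psi (exp y))) +
        (I y *\<^sub>R exp (- ((s - 1) / 2) * of_real y) - I y *\<^sub>R exp (- (s / 2) * of_real y)) / 2) = (\<lambda>y. g y + h y)"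
      unfolding g_def h_def ..
    moreover have "(\<integral>y. g y + h y \<partial>lborel) = (\<integral>y. g y \<partial>lborel) + (\<integral>y. h y \<partial>lborel)"
      by (rule Bochner_Integration.integral_add[OF int_g int_h(1)])
    moreover have "(\<integral>y. 2 * cosh ((s - 1 / 2) * of_real y / 2) * of_real (xi_kernel y) \<partial>lborel) =
        (\<integral>y. I y *\<^sub>R f y \<partial>lborel) + (\<integral>y. g y \<partial>lborel)"
      unfolding sum[symmetric] by (rule Bochner_Integration.integral_add[OF int_pos int_g])
    ultimately show ?thesis
      by (simp only: int_h(2) add.assoc)
  qed
  also have "(1 / ((s - 1) / 2) - 1 / (s / 2)) / 2 = 1 / (s * (s - 1))"
  proof -
    have "s \<noteq> 0" "s - 1 \<noteq> 0" using s by auto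
    thus ?thesis by (simp add: field_simps)
  qed
  finally show ?thesis
    unfolding xi_series_square f_def by (rule trans[OF _ add.commute])
qed

section \<open>Entire functions of minimal exponential type\<close>

text \<open>The map from \<open>g\<close> to \<open>g / (2 * A - g)\<close> sends the half-plane
  \<open>Re < A\<close> into the unit disc and fixes 0, so the Schwarz lemma applies.\<close>

lemma borel_caratheodory:
  fixes g :: "complex \<Rightarrow> complex"
  assumes hol: "g holomorphic_on ball 0 R" and g0: "g 0 = 0" and "A > 0" "R > 0"
      and Re_less: "\<And>z. norm z < R \<Longrightarrow> Re (g z) < A" and w: "norm w < R"
  shows "norm (g w) \<le> 2 * A * norm w / (R - norm w)"
proof -
  define \<phi> where "\<phi> = (\<lambda>z. g (of_real R * z) / (2 * of_real A - g (of_real R * z)))"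
  have scale: "norm (of_real R * z) < R" if "norm z < 1" for z :: complex
    using that \<open>R > 0\<close> by (simp add: norm_mult)
  have less: "norm (g z) < norm (2 * of_real A - g z)" if "norm z < R" for z
  proof -
    have "norm (2 * of_real A - g z) ^ 2 - norm (g z) ^ 2 = 4 * A * (A - Re (g z))"
      unfolding cmod_power2 by (simp add: power2_eq_square algebra_simps)
    also have "\<dots> > 0" using Re_less[OF that] \<open>A > 0\<close> by simp
    finally show ?thesis by (simp add: power2_less_imp_less)
  qed
  have nz: "2 * of_real A - g z \<noteq> 0" if "norm z < R" for z
    using less[OF that] by auto
  have "\<phi> holomorphic_on ball 0 1"
    unfolding \<phi>_def
    by (intro holomorphic_intros holomorphic_on_compose_gen[OF _ hol, unfolded o_def])
       (use scale nz in auto)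
  moreover have "norm (\<phi> z) < 1" if "norm z < 1" for z
    using less[OF scale[OF that]] by (simp add: \<phi>_def norm_divide divide_less_eq)
  moreover have "norm (w / of_real R) < 1"
    using w \<open>R > 0\<close> by (simp add: norm_divide)
  ultimately have "norm (\<phi> (w / of_real R)) \<le> norm (w / of_real R)"
    by (intro Schwarz_Lemma(1)) (auto simp: \<phi>_def g0)
  hence le: "norm (g w) \<le> norm w / R * norm (2 * of_real A - g w)"
    using \<open>R > 0\<close> nz[OF w] by (simp add: \<phi>_def norm_divide divide_simps mult_ac)
  also have "\<dots> \<le> norm w / R * (2 * A + norm (g w))"
    using \<open>A > 0\<close> \<open>R > 0\<close> norm_triangle_ineq4[of "2 * of_real A" "g w"]
    by (intro mult_left_mono) (auto simp: norm_mult)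
  finally have "norm (g w) * (R - norm w) \<le> 2 * A * norm w"
    using \<open>R > 0\<close> by (simp add: field_simps)
  thus ?thesis using w by (simp add: pos_le_divide_eq)
qed

lemma norm_exp_minus_one_le: "norm (exp z - 1) \<le> exp (norm z) - 1"
  for z :: complex
proof -
  have s: "(\<lambda>n. z ^ Suc n /\<^sub>R fact (Suc n)) sums (exp z - 1)"
    using sums_Suc_iff[of "\<lambda>n. z ^ n /\<^sub>R fact n" "exp z - 1"] exp_converges[of z] by simp
  have s': "(\<lambda>n. norm z ^ Suc n /\<^sub>R fact (Suc n)) sums (exp (norm z) - 1)"
    using sums_Suc_iff[of "\<lambda>n. norm z ^ n /\<^sub>R fact n" "exp (norm z) - 1"] exp_converges[of "norm z"] by simp
  have n: "norm (z ^ Suc n /\<^sub>R fact (Suc n)) = norm z ^ Suc n /\<^sub>R fact (Suc n)" for n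
    by (simp add: norm_power norm_mult del: fact_Suc)
  have "summable (\<lambda>n. norm (z ^ Suc n /\<^sub>R fact (Suc n)))"
    unfolding n using s' by (rule sums_summable)
  from summable_norm[OF this] show ?thesis
    unfolding n sums_unique[OF s, symmetric] sums_unique[OF s', symmetric] .
qed

text \<open>A truncated canonical product of genus 0. Truncation by modulus keeps it finite, and
  \<open>nat\<close> turns the integer order into an exponent; orders at zeros of the functions
  considered are positive.\<close>

definition zeros_product :: "(complex \<Rightarrow> complex) \<Rightarrow> real \<Rightarrow> complex \<Rightarrow> complex" where
  "zeros_product F R w = (\<Prod>\<rho> | norm \<rho> \<le> R \<and> F \<rho> = 0. (1 - w / \<rho>) ^ nat (zorder F \<rho>))"

lemma finite_zeros_cball:
  assumes "F holomorphic_on UNIV" "F a \<noteq> 0"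
  shows "finite {\<rho>. norm \<rho> \<le> R \<and> F \<rho> = 0}"
proof (cases "F constant_on UNIV")
  case True
  then obtain c where "\<And>z. F z = c" by (auto simp: constant_on_def)
  thus ?thesis using assms by simp
next
  case False
  have "finite {\<rho> \<in> cball 0 R. F \<rho> = 0}"
    by (rule holomorphic_compact_finite_zeros[OF assms(1)]) (use False in auto)
  thus ?thesis by simp
qed

lemma zorder_pos_at_zero:
  assumes "F holomorphic_on UNIV" "F a \<noteq> 0" "F \<rho> = 0"
  shows "zorder F \<rho> > 0"
  using zorder_exist_zero[of F UNIV \<rho>] assms by auto

text \<open>The quotient \<open>H = F / P\<close> is entire. On the circle of radius
  \<open>4 * R\<close> every factor of \<open>P\<close> has modulus at least 1, so the bound on
  \<open>F\<close> passes to \<open>H\<close> and, by the maximum principle, to the disc. In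
  \<open>ball 0 R\<close> the quotient has no zeros, so Borel-Caratheodory bounds its logarithm at
  \<open>w\<close> by a quantity close to \<open>8 * \<epsilon> * norm w\<close> for large
  \<open>R\<close>.\<close>

lemma zeros_product_approx:
  fixes F :: "complex \<Rightarrow> complex"
  assumes hol: "F holomorphic_on UNIV" and F0: "F 0 = 1"
      and C: "\<And>w. norm (F w) \<le> C * exp (\<epsilon> * norm w)" and "\<epsilon> > 0"
      and w: "norm w < R"
  shows "norm (zeros_product F R w - F w) \<le>
           norm (F w) * (exp (2 * (ln C + 4 * \<epsilon> * R + 1) * norm w / (R - norm w)) - 1)"
proof -
  have R: "R > 0" using w norm_ge_zero[of w] by linarith
  define P where "P = zeros_product F R"
  define Z where "Z = {\<rho>. norm \<rho> \<le> R \<and> F \<rho> = 0}"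
  have finZ: "finite Z" unfolding Z_def using hol F0 by (intro finite_zeros_cball[of F 0]) auto
  have Z0: "\<rho> \<noteq> 0" if "\<rho> \<in> Z" for \<rho> using that F0 by (auto simp: Z_def)
  have P_eq: "P w = (\<Prod>\<rho>\<in>Z. (1 - w / \<rho>) ^ nat (zorder F \<rho>))" for w
    by (simp add: P_def zeros_product_def Z_def)
  have P_hol: "P holomorphic_on A" for A
    unfolding P_eq by (intro holomorphic_intros) (use Z0 in auto)
  have ord: "nat (zorder F \<rho>) > 0" if "\<rho> \<in> Z" for \<rho>
    using zorder_pos_at_zero[OF hol, of 0 \<rho>] F0 that by (auto simp: Z_def)
  have P_0: "P z = 0 \<longleftrightarrow> z \<in> Z" for z
    using finZ Z0 ord by (auto simp: P_eq)
  have "finite {\<rho>. norm \<rho> \<le> R + 1 \<and> F \<rho> = 0}"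
    using hol F0 by (intro finite_zeros_cball[of F 0]) auto
  define W where "W = norm ` ({\<rho>. norm \<rho> \<le> R + 1 \<and> F \<rho> = 0} - Z)"
  have "finite W" unfolding W_def using \<open>finite {\<rho>. norm \<rho> \<le> R + 1 \<and> F \<rho> = 0}\<close> by auto
  \<comment> \<open>A radius slightly above \<open>R\<close> that admits no further zeros: zeros of
    modulus exactly \<open>R\<close> belong to \<open>Z\<close>, and the open disc must overlap the
    complement of \<open>cball 0 R\<close> for the gluing below.\<close>
  define R' where "R' = Min (insert (R + 1) W)"
  have R': "R' > R" unfolding R'_def using \<open>finite W\<close> by (auto simp: W_def Z_def)
  have R'_zeros: "\<rho> \<in> Z" if "norm \<rho> < R'" "F \<rho> = 0" for \<rho>
  proof (rule ccontr)
    assume "\<rho> \<notin> Z"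
    moreover have "R' \<le> R + 1" unfolding R'_def using \<open>finite W\<close> by simp
    ultimately have "norm \<rho> \<in> W" using that by (auto simp: W_def)
    hence "R' \<le> norm \<rho>" unfolding R'_def using \<open>finite W\<close> by simp
    thus False using that by simp
  qed
  obtain h where h: "h holomorphic_on ball 0 R'" "\<And>z. z \<in> ball 0 R' \<Longrightarrow> h z \<noteq> 0"
       "\<And>z. z \<in> ball 0 R' \<Longrightarrow> F z = h z * P z"
  proof (rule holomorphic_zorder_factorization[of F "ball 0 R'" P])
    show "F holomorphic_on ball 0 R'" using hol by (rule holomorphic_on_subset) auto
    show "P z = 0 \<longleftrightarrow> F z = 0" if "z \<in> ball 0 R'" for z
      using that R'_zeros[of z] by (auto simp: P_0) (auto simp: Z_def)
    show "zorder P z = zorder F z" if "z \<in> ball 0 R'" for z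
    proof (cases "z \<in> Z")
      case False
      hence "F z \<noteq> 0" "P z \<noteq> 0" using R'_zeros[of z] that P_0 by auto
      moreover have "F analytic_on {z}" "P analytic_on {z}"
        using hol P_hol[of UNIV] by (auto intro: holomorphic_on_imp_analytic_at)
      ultimately show ?thesis by (simp add: zorder_eq_0I)
    next
      case True
      define n where "n = nat (zorder F z)"
      have n: "int n = zorder F z" using ord[OF True] by (simp add: n_def)
      define G where "G = (\<lambda>w. (\<Prod>\<rho>\<in>Z - {z}. (1 - w / \<rho>) ^ nat (zorder F \<rho>)) * (- 1 / z) ^ n)"
      have "zorder P z = int n"
      proof (rule zorder_eqI[of UNIV _ G])
        show "G holomorphic_on UNIV" unfolding G_def by (intro holomorphic_intros) (use Z0 in auto)
        show "G z \<noteq> 0" using finZ Z0 True by (auto simp: G_def)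
        fix w
        have "1 - w / z = (- 1 / z) * (w - z)"
          using Z0[OF True] by (simp add: field_simps)
        hence "(1 - w / z) ^ n = (- 1 / z) ^ n * (w - z) ^ n"
          by (simp only: power_mult_distrib)
        thus "P w = G w * (w - z) powi int n"
          unfolding P_eq G_def by (subst prod.remove[OF finZ True]) (simp add: n_def[symmetric] mult_ac)
      qed auto
      thus ?thesis using n by simp
    qed
  qed (auto simp: P_hol)
  \<comment> \<open>The quotient without division by zero: \<open>h\<close> near the zeros of
    \<open>P\<close>, the plain quotient elsewhere; both agree on the overlapping annulus.\<close>
  define H where "H = (\<lambda>z. if z \<in> ball 0 R' then h z else F z / P z)"
  have H_hol: "H holomorphic_on UNIV"
  proof -
    have "H holomorphic_on (ball 0 R' \<union> - cball 0 R)"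
      unfolding H_def
    proof (rule holomorphic_on_If_Un)
      show "(\<lambda>z. F z / P z) holomorphic_on - cball 0 R"
        by (intro holomorphic_intros P_hol holomorphic_on_subset[OF hol]) (auto simp: P_0 Z_def)
      show "h z = F z / P z" if "z \<in> ball 0 R'" "z \<in> - cball 0 R" for z
        using that h(3)[of z] P_0[of z] by (auto simp: Z_def)
    qed (use h in auto)
    moreover have "ball 0 R' \<union> - cball 0 R = (UNIV :: complex set)" using R' by force
    ultimately show ?thesis by simp
  qed
  have FH: "F z = H z * P z" for z
  proof (cases "z \<in> ball 0 R'")
    case False
    hence "P z \<noteq> 0" using R' by (auto simp: P_0 Z_def)
    thus ?thesis using False by (simp add: H_def)
  qed (use h in \<open>auto simp: H_def\<close>)
  have P_at_0: "P 0 = 1" by (simp add: P_eq)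
  have H_0: "H 0 = 1" using FH[of 0] P_at_0 F0 by simp
  have C1: "C \<ge> 1" using C[of 0] F0 by simp
  \<comment> \<open>The summand 1 makes the bound on the real part strict, as Borel-Caratheodory
    requires.\<close>
  define A where "A = ln C + 4 * \<epsilon> * R + 1"
  have A: "A > 0" unfolding A_def using C1 R \<open>\<epsilon> > 0\<close> by (simp add: add_nonneg_pos)
  have H_le: "norm (H z) \<le> C * exp (4 * \<epsilon> * R)" if "norm z \<le> 4 * R" for z
  proof (rule maximum_modulus_frontier[of H "cball 0 (4 * R)"])
    show "norm (H z) \<le> C * exp (4 * \<epsilon> * R)" if "z \<in> frontier (cball 0 (4 * R))" for z
    proof -
      have z: "norm z = 4 * R" using that R by (simp add: frontier_cball)
      have "norm (P z) \<ge> 1"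
        unfolding P_eq prod_norm[symmetric]
      proof (intro prod_ge_1)
        fix \<rho> assume \<rho>: "\<rho> \<in> Z"
        \<comment> \<open>Modulus at least 2 is what makes the distance to 1 at least 1; the radius
          \<open>4 * R\<close> leaves a margin.\<close>
        have "1 + 1 \<le> norm (z / \<rho>)"
          using \<rho> Z0[OF \<rho>] z R by (auto simp: norm_divide divide_simps Z_def)
        also have "\<dots> \<le> norm (1 - z / \<rho>) + 1"
          using norm_triangle_ineq2[of "z / \<rho>" 1] by (simp add: norm_minus_commute)
        finally show "1 \<le> norm ((1 - z / \<rho>) ^ nat (zorder F \<rho>))"
          by (simp add: norm_power)
      qed
      have "norm (H z) * 1 \<le> norm (H z) * norm (P z)"
        using \<open>norm (P z) \<ge> 1\<close> by (intro mult_left_mono) auto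
      also have "\<dots> = norm (F z)" by (simp add: FH norm_mult)
      also have "\<dots> \<le> C * exp (4 * \<epsilon> * R)" using C[of z] z by (simp add: mult_ac)
      finally show ?thesis by simp
    qed
  qed (use that H_hol in \<open>auto intro: holomorphic_on_subset holomorphic_on_imp_continuous_on\<close>)
  have "contractible (ball (0::complex) R)"
    by (rule convex_imp_contractible) auto
  moreover have "H holomorphic_on ball 0 R" "\<And>z. z \<in> ball 0 R \<Longrightarrow> H z \<noteq> 0"
    using H_hol h(2) R' by (auto intro: holomorphic_on_subset simp: H_def)
  ultimately obtain g where g: "g holomorphic_on ball 0 R" "\<And>z. z \<in> ball 0 R \<Longrightarrow> H z = exp (g z)"
    by (metis contractible_imp_holomorphic_log)
  have eg0: "exp (g 0) = 1" using g(2)[of 0] H_0 R by simp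
  \<comment> \<open>Subtracting \<open>g 0\<close> normalises the logarithm to vanish at 0 and
    leaves its exponential unchanged, since \<open>exp (g 0) = 1\<close>.\<close>
  define g' where "g' = (\<lambda>z. g z - g 0)"
  have g': "H z = exp (g' z)" if "norm z < R" for z
    using g(2)[of z] that eg0 by (simp add: g'_def exp_diff)
  have "norm (g' w) \<le> 2 * A * norm w / (R - norm w)"
  proof (rule borel_caratheodory[OF _ _ A R _ w])
    show "g' holomorphic_on ball 0 R" unfolding g'_def by (intro holomorphic_intros g)
    show "Re (g' z) < A" if "norm z < R" for z
    proof -
      have "exp (Re (g' z)) = norm (H z)" by (simp add: g'[OF that])
      also have "\<dots> \<le> C * exp (4 * \<epsilon> * R)" using H_le[of z] that R by simp
      also have "\<dots> = exp (ln C + 4 * \<epsilon> * R)" using C1 by (simp add: exp_add)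
      finally show ?thesis by (simp add: A_def)
    qed
  qed (simp add: g'_def)
  have "P w - F w = F w * (exp (- g' w) - 1)"
    using FH[of w] g'[OF w] by (simp add: algebra_simps exp_minus)
  hence "norm (P w - F w) = norm (F w) * norm (exp (- g' w) - 1)"
    by (simp add: norm_mult)
  also have "\<dots> \<le> norm (F w) * (exp (norm (g' w)) - 1)"
    using norm_exp_minus_one_le[of "- g' w"] by (intro mult_left_mono) auto
  also have "\<dots> \<le> norm (F w) * (exp (2 * A * norm w / (R - norm w)) - 1)"
    using \<open>norm (g' w) \<le> _\<close> by (intro mult_left_mono) auto
  finally show ?thesis by (simp add: P_def A_def)
qed

text \<open>
  Hadamard's factorisation for minimal exponential type. Convergence of the product is part of
  the conclusion, so no bound on the number of zeros (Jensen's formula) is needed.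
\<close>
theorem zeros_product_tendsto:
  fixes F :: "complex \<Rightarrow> complex"
  assumes hol: "F holomorphic_on UNIV" and F0: "F 0 = 1"
      and growth: "\<And>\<epsilon>. \<epsilon> > 0 \<Longrightarrow> \<exists>C. \<forall>w. norm (F w) \<le> C * exp (\<epsilon> * norm w)"
  shows "((\<lambda>R. zeros_product F R w) \<longlongrightarrow> F w) at_top"
proof (rule tendstoI)
  fix e :: real assume e: "e > 0"
  have "((\<lambda>\<epsilon>. norm (F w) * (exp (\<epsilon> * (8 * norm w + 1)) - 1)) \<longlongrightarrow> norm (F w) * (exp (0 * (8 * norm w + 1)) - 1)) (at_right 0)"
    by (intro tendsto_intros)
  hence "eventually (\<lambda>\<epsilon>. norm (F w) * (exp (\<epsilon> * (8 * norm w + 1)) - 1) < e) (at_right 0)"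
    using e by (intro order_tendstoD(2)) auto
  moreover have "eventually (\<lambda>\<epsilon>::real. \<epsilon> > 0) (at_right 0)"
    by (simp add: eventually_at_filter)
  ultimately have "eventually (\<lambda>\<epsilon>. norm (F w) * (exp (\<epsilon> * (8 * norm w + 1)) - 1) < e \<and> \<epsilon> > 0) (at_right 0)"
    by (rule eventually_conj)
  then obtain \<epsilon> where \<epsilon>: "norm (F w) * (exp (\<epsilon> * (8 * norm w + 1)) - 1) < e" "\<epsilon> > 0"
    using eventually_happens[of _ "at_right (0::real)"] by (auto simp: trivial_limit_at_right_real)
  from growth[OF \<epsilon>(2)] obtain C where C: "\<And>w. norm (F w) \<le> C * exp (\<epsilon> * norm w)" by auto
  define n where "n = norm w"
  have "((\<lambda>R. 2 * (ln C + 4 * \<epsilon> * R + 1) * n / (R - n)) \<longlongrightarrow> 8 * \<epsilon> * n) at_top"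
    by real_asymp
  \<comment> \<open>The \<open>+ 1\<close> gives strict room above the limit, also for
    \<open>w = 0\<close>. The order of choices matters: \<open>\<epsilon>\<close> first, then
    \<open>C\<close> depending on it, then \<open>R\<close>.\<close>
  moreover have "8 * \<epsilon> * n < \<epsilon> * (8 * n + 1)" using \<epsilon> by (simp add: algebra_simps)
  ultimately have "eventually (\<lambda>R. 2 * (ln C + 4 * \<epsilon> * R + 1) * n / (R - n) < \<epsilon> * (8 * n + 1)) at_top"
    by (rule order_tendstoD(2))
  moreover have "eventually (\<lambda>R. R > n) at_top" by (rule eventually_gt_at_top)
  ultimately show "eventually (\<lambda>R. dist (zeros_product F R w) (F w) < e) at_top"
  proof eventually_elim
    case (elim R)
    have "norm (zeros_product F R w - F w) \<le>
           norm (F w) * (exp (2 * (ln C + 4 * \<epsilon> * R + 1) * n / (R - n)) - 1)"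
      unfolding n_def by (rule zeros_product_approx[OF hol F0 C \<epsilon>(2)]) (use elim in \<open>simp add: n_def\<close>)
    also have "\<dots> \<le> norm (F w) * (exp (\<epsilon> * (8 * n + 1)) - 1)"
      using elim by (intro mult_left_mono) auto
    also have "\<dots> < e" using \<epsilon> by (simp add: n_def)
    finally show ?case by (simp add: dist_norm)
  qed
qed

section \<open>The zeta function\<close>

text \<open>
  The completed zeta function as a function of \<open>w = s - s\<^sup>2\<close>, so that the functional equation
  \<open>s \<mapsto> 1 - s\<close> is built in.
\<close>
definition Xi :: "complex \<Rightarrow> complex" where
  "Xi w = 1 / 2 - w / 2 * xi_series (1 / 4 - w)"

lemma Xi_0: "Xi 0 = 1 / 2"
  by (simp add: Xi_def)

lemma Xi_holomorphic: "Xi holomorphic_on A"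
  unfolding Xi_def
  by (intro holomorphic_intros holomorphic_on_compose_gen[OF _ xi_series_holomorphic[of UNIV], unfolded o_def]) auto

text \<open>This is \<open>zeta (1/2) \<noteq> 0\<close>: the value \<open>1/4\<close> is the branch
  value of \<open>s - s^2\<close>, whose only preimage \<open>1/2\<close> has imaginary part 0 and
  could not be listed.\<close>

lemma Xi_quarter_nonzero: "Xi (1 / 4) \<noteq> 0"
proof
  assume "Xi (1 / 4) = 0"
  hence "xi_series 0 = 4" by (simp add: Xi_def)
  thus False using norm_xi_series_0 by simp
qed

lemma Xi_growth:
  assumes "\<epsilon> > 0"
  shows "\<exists>C. \<forall>w. norm (2 * Xi w) \<le> C * exp (\<epsilon> * norm w)"
proof -
  obtain C where C: "\<And>u. norm (xi_series u) \<le> C * exp (\<epsilon> / 2 * norm u)"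
    using xi_series_bound[of "\<epsilon> / 2"] assms by auto
  have C0: "C \<ge> 0" using C[of 0] order_trans[OF norm_ge_zero] by fastforce
  show ?thesis
  proof (intro exI allI)
    fix w :: complex
    define D where "D = C * exp (\<epsilon> / 8) * (2 / \<epsilon>)"
    have "norm (1 / 4 - w) \<le> 1 / 4 + norm w"
      using norm_triangle_ineq4[of "1 / 4" w] by simp
    hence "C * exp (\<epsilon> / 2 * norm (1 / 4 - w)) \<le> C * exp (\<epsilon> / 2 * (1 / 4 + norm w))"
      using assms C0 by (intro mult_left_mono) auto
    with C have "norm (xi_series (1 / 4 - w)) \<le> C * exp (\<epsilon> / 2 * (1 / 4 + norm w))"
      by (rule order.trans)
    hence "norm w * norm (xi_series (1 / 4 - w)) \<le> norm w * (C * exp (\<epsilon> / 2 * (1 / 4 + norm w)))"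
      by (intro mult_left_mono) auto
    also have "\<dots> = C * exp (\<epsilon> / 8) * (norm w * exp (\<epsilon> / 2 * norm w))"
      by (simp add: distrib_left exp_add)
    also have "\<dots> \<le> C * exp (\<epsilon> / 8) * ((2 / \<epsilon> * exp (\<epsilon> / 2 * norm w)) * exp (\<epsilon> / 2 * norm w))"
    proof (intro mult_left_mono mult_right_mono)
      have "\<epsilon> / 2 * norm w \<le> exp (\<epsilon> / 2 * norm w)"
        using exp_ge_add_one_self[of "\<epsilon> / 2 * norm w"] by linarith
      thus "norm w \<le> 2 / \<epsilon> * exp (\<epsilon> / 2 * norm w)"
        using assms by (simp add: field_simps)
    qed (use C0 in auto)
    also have "\<dots> = D * exp (\<epsilon> * norm w)"
      by (simp add: D_def mult.assoc flip: exp_add)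
    finally have "norm w * norm (xi_series (1 / 4 - w)) \<le> D * exp (\<epsilon> * norm w)" .
    moreover have "2 * Xi w = 1 - w * xi_series (1 / 4 - w)" by (simp add: Xi_def algebra_simps)
    hence "norm (2 * Xi w) \<le> 1 + norm w * norm (xi_series (1 / 4 - w))"
      using norm_triangle_ineq4[of 1 "w * xi_series (1 / 4 - w)"] by (simp add: norm_mult)
    moreover have "1 \<le> exp (\<epsilon> * norm w)" using assms by simp
    ultimately have "norm (2 * Xi w) \<le> exp (\<epsilon> * norm w) + D * exp (\<epsilon> * norm w)" by linarith
    thus "norm (2 * Xi w) \<le> (1 + C * exp (\<epsilon> / 8) * (2 / \<epsilon>)) * exp (\<epsilon> * norm w)"
      by (simp only: D_def distrib_right mult_1)
  qed
qed

text \<open>In this half-plane the factor between \<open>zeta\<close> and \<open>Xi\<close> has no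
  zeros; the trivial zeros, where it vanishes, lie to the left.\<close>

lemma rGamma_shift_nonzero:
  assumes "Re s \<ge> 0"
  shows "rGamma (s / 2 + 1) \<noteq> (0 :: complex)"
proof -
  have "s / 2 + 1 \<notin> \<int>\<^sub>\<le>\<^sub>0"
    using assms by (auto elim!: nonpos_Ints_cases simp: complex_eq_iff)
  thus ?thesis by (simp add: rGamma_eq_zero_iff)
qed

text \<open>The factor \<open>s / 2 * Gamma (s / 2)\<close> is absorbed into
  \<open>rGamma (s / 2 + 1)\<close>, which is entire. Hence the right-hand side is holomorphic away
  from 1 and serves as the continuation itself.\<close>

lemma Xi_dirichlet_series:
  assumes s: "Re s > 1"
  shows "(\<lambda>n. 1 / of_nat (Suc n) powr s) sums (Xi (s - s ^ 2) * of_real pi powr (s / 2) * rGamma (s / 2 + 1) / (s - 1))"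
proof -
  have s01: "s \<noteq> 0" "s \<noteq> 1" using s by auto
  have s2: "s / 2 \<notin> \<int>\<^sub>\<le>\<^sub>0" using s by (auto elim!: nonpos_Ints_cases simp: complex_eq_iff)
  have G: "Gamma (s / 2 + 1) = s / 2 * Gamma (s / 2)"
    using Gamma_plus1[OF s2] by simp
  have G0: "Gamma (s / 2) \<noteq> 0" using s2 by (simp add: Gamma_eq_zero_iff)
  define J where "J = 1 / (s * (s - 1)) + xi_series ((s - 1 / 2) ^ 2)"
  define c where "c = Gamma (s / 2) * of_real pi powr (- s / 2)"
  have c0: "c \<noteq> 0" using G0 by (simp add: c_def powr_def)
  have "(\<lambda>n. c * (1 / of_nat (Suc n) powr s)) sums J"
    using mellin_psi(2)[OF s] mellin_psi_xi_series[OF s] by (simp add: c_def J_def)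
  from sums_mult[OF this, of "1 / c"] have "(\<lambda>n. 1 / of_nat (Suc n) powr s) sums (J / c)"
    using c0 by (simp del: of_nat_Suc)
  also have "J / c = Xi (s - s ^ 2) * of_real pi powr (s / 2) * rGamma (s / 2 + 1) / (s - 1)"
  proof -
    have "(s - 1 / 2) ^ 2 = 1 / 4 - (s - s ^ 2)"
      by (simp add: power2_eq_square algebra_simps)
    hence e1: "Xi (s - s ^ 2) = s * (s - 1) / 2 * J"
      using s01 unfolding Xi_def J_def by (simp add: power2_eq_square field_simps)
    have e2: "of_real pi powr (s / 2) = 1 / (of_real pi powr (- s / 2))"
      by (simp add: powr_minus_divide)
    have e3: "rGamma (s / 2 + 1) = 1 / (s / 2 * Gamma (s / 2))"
      unfolding G[symmetric] by (simp add: rGamma_inverse_Gamma inverse_eq_divide)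
    show ?thesis
      unfolding e1 e2 e3 c_def using s01 G0 by simp
  qed
  finally show ?thesis .
qed

text \<open>Existence, needed before the definite description in \<open>zeta\<close> says
  anything.\<close>

lemma zeta_continuation:
  "is_zeta_continuation (\<lambda>s. if s = 1 then 0 else Xi (s - s ^ 2) * of_real pi powr (s / 2) * rGamma (s / 2 + 1) / (s - 1))"
  (is "is_zeta_continuation ?f")
proof -
  have "(\<lambda>s. Xi (s - s ^ 2) * of_real pi powr (s / 2) * rGamma (s / 2 + 1) / (s - 1)) holomorphic_on - {1}"
    by (intro holomorphic_intros holomorphic_on_compose_gen[OF _ Xi_holomorphic[of UNIV], unfolded o_def]
          holomorphic_on_compose_gen[OF _ holomorphic_rGamma[of UNIV], unfolded o_def]) auto
  hence "?f holomorphic_on - {1}"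
    by (rule holomorphic_transform) auto
  thus ?thesis
    unfolding is_zeta_continuation_def using Xi_dirichlet_series by auto
qed

lemma zeta_is_continuation: "is_zeta_continuation zeta"
  unfolding zeta_def
  by (rule theI[of is_zeta_continuation, OF zeta_continuation]) (rule is_zeta_continuation_unique[OF _ zeta_continuation])

lemma zeta_eq_Xi:
  "s \<noteq> 1 \<Longrightarrow> zeta s = Xi (s - s ^ 2) * of_real pi powr (s / 2) * rGamma (s / 2 + 1) / (s - 1)"
  using fun_cong[OF is_zeta_continuation_unique[OF zeta_is_continuation zeta_continuation], of s] by simp

lemma zeta_sums: "Re s > 1 \<Longrightarrow> (\<lambda>n. 1 / of_nat (Suc n) powr s) sums zeta s"
  using zeta_is_continuation by (simp add: is_zeta_continuation_def)

section \<open>Zeta in the half-plane of absolute convergence\<close>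

lemma norm_inverse_nat_powr:
  "norm (1 / of_nat (Suc n) powr s :: complex) = real (Suc n) powr (- Re s)"
  using norm_powr_real_powr[of "of_nat (Suc n)" s] by (simp add: norm_divide powr_minus_divide del: of_nat_Suc)

text \<open>If \<open>zeta s\<close> were 0, sieving out the multiples of finitely many primes would
  leave a sum that is still 0. But that sum is 1 plus a tail over integers above \<open>N\<close>,
  and the tail is small by absolute convergence.\<close>

lemma zeta_nonzero:
  assumes s: "Re s > 1"
  shows "zeta s \<noteq> 0"
proof
  assume z: "zeta s = 0"
  define t where "t = (\<lambda>n. 1 / of_nat n powr s :: complex)"
  have summ: "summable (\<lambda>n. norm (t (Suc n)))"
    unfolding t_def norm_inverse_nat_powr using s
    by (subst summable_Suc_iff) (simp add: summable_real_powr_iff)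
  hence "(\<lambda>n. t (Suc n)) summable_on UNIV" "(\<lambda>n. norm (t (Suc n))) summable_on UNIV"
    by (auto intro: norm_summable_imp_summable_on)
  moreover have img: "{1..} = Suc ` UNIV"
    by (auto simp: image_iff Suc_le_eq gr0_conv_Suc)
  ultimately have ts: "t summable_on {1..}" and tn: "(\<lambda>n. norm (t n)) summable_on {1..}"
    unfolding img by (simp_all only: summable_on_reindex inj_Suc o_def)
  have "((\<lambda>n. t (Suc n)) has_sum zeta s) UNIV"
    using norm_summable_imp_has_sum[OF summ] zeta_sums[OF s] by (simp add: t_def)
  hence inf0: "infsum t {1..} = 0"
    unfolding img z by (simp only: infsum_reindex inj_Suc o_def infsumI)
  \<comment> \<open>Sieve of Eratosthenes: \<open>infsum t (S N)\<close> is \<open>zeta s\<close> times the Euler factors up to \<open>N\<close>.\<close>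
  define S where "S = (\<lambda>N. {n::nat. n \<ge> 1 \<and> (\<forall>p. prime p \<and> p \<le> N \<longrightarrow> \<not> p dvd n)})"
  have S_sub: "S N \<subseteq> {1..}" for N by (auto simp: S_def)
  have tS: "t summable_on A" "(\<lambda>n. norm (t n)) summable_on A" if "A \<subseteq> {1..}" for A
    using summable_on_subset_banach[OF ts that] summable_on_subset_banach[OF tn that] by auto
  have zero: "infsum t (S N) = 0" for N
  proof (induction N)
    case 0
    have "S 0 = {1..}" by (auto simp: S_def)
    thus ?case using inf0 by simp
  next
    case (Suc N)
    show ?case
    proof (cases "prime (Suc N)")
      case False
      have "S (Suc N) = S N" using False by (auto simp: S_def le_Suc_eq)
      thus ?thesis using Suc by simp
    next
      case True
      define p where "p = Suc N"
      have p: "prime p" using True by (simp add: p_def)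
      \<comment> \<open>Members of \<open>S N\<close> divisible by the prime
        \<open>p = Suc N\<close> are exactly \<open>p\<close> times members of \<open>S N\<close>.
        As \<open>t\<close> is multiplicative, the sum over \<open>S (Suc N)\<close> is
        \<open>1 - t p\<close> times the sum over \<open>S N\<close>.\<close>
      have un: "S N = S (Suc N) \<union> (\<lambda>n. p * n) ` S N"
      proof (intro equalityI subsetI)
        fix n assume n: "n \<in> S N"
        show "n \<in> S (Suc N) \<union> (\<lambda>n. p * n) ` S N"
        proof (cases "p dvd n")
          case True
          then obtain m where m: "n = p * m" by auto
          have "m \<in> S N" using n by (auto simp: S_def m)
          thus ?thesis using m by auto
        next
          case False
          thus ?thesis using n by (auto simp: S_def le_Suc_eq p_def)
        qed
      next
        fix n assume "n \<in> S (Suc N) \<union> (\<lambda>n. p * n) ` S N"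
        thus "n \<in> S N"
        proof
          assume "n \<in> (\<lambda>n. p * n) ` S N"
          then obtain m where m: "m \<in> S N" "n = p * m" by auto
          have "\<not> q dvd n" if q: "prime q" "q \<le> N" for q
          proof
            assume "q dvd n"
            hence "q dvd p \<or> q dvd m" using q m by (simp add: prime_dvd_mult_iff)
            moreover have "\<not> q dvd m" using m q by (auto simp: S_def)
            ultimately have "q = p" using p q primes_dvd_imp_eq by blast
            thus False using q by (simp add: p_def)
          qed
          moreover have "n \<ge> 1" using m p by (auto simp: S_def prime_gt_0_nat Suc_le_eq)
          ultimately show ?thesis by (auto simp: S_def)
        qed (auto simp: S_def)
      qed
      have disj: "S (Suc N) \<inter> (\<lambda>n. p * n) ` S N = {}"
      proof -
        have "\<not> p dvd n" if "n \<in> S (Suc N)" for n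
          using that p by (auto simp: S_def p_def)
        thus ?thesis by fastforce
      qed
      have sub2: "(\<lambda>n. p * n) ` S N \<subseteq> {1..}" using un S_sub by blast
      have "infsum t (S N) = infsum t (S (Suc N)) + infsum t ((\<lambda>n. p * n) ` S N)"
        by (subst un, rule infsum_Un_disjoint) (intro tS S_sub sub2 disj)+
      also have "infsum t ((\<lambda>n. p * n) ` S N) = infsum (\<lambda>n. t (p * n)) (S N)"
        using p by (subst infsum_reindex) (auto simp: inj_on_def o_def)
      also have "\<dots> = infsum (\<lambda>n. t p * t n) (S N)"
      proof (intro infsum_cong)
        fix n
        have "complex_of_nat (p * n) powr s = of_nat p powr s * of_nat n powr s"
          using powr_times_real[of "of_nat p" "of_nat n" s] by simp
        thus "t (p * n) = t p * t n" by (simp add: t_def)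
      qed
      also have "\<dots> = t p * infsum t (S N)"
        by (intro infsum_cmult_right tS S_sub)
      finally show ?thesis using Suc by simp
    qed
  qed
  \<comment> \<open>\<open>F\<close> carries all but \<open>1/2\<close> of the absolute sum. For
    \<open>N\<close> at least \<open>Max F\<close>, every member of \<open>S N\<close> other than 1
    has a prime factor above \<open>N\<close> and so lies outside \<open>F\<close>.\<close>
  have "((\<lambda>n. norm (t n)) has_sum infsum (\<lambda>n. norm (t n)) {1..}) {1..}"
    using tn by (rule has_sum_infsum)
  from has_sum_finite_approximation[OF this, of "1 / 2"]
  obtain F where F: "finite F" "F \<subseteq> {1..}" "dist (sum (\<lambda>n. norm (t n)) F) (infsum (\<lambda>n. norm (t n)) {1..}) \<le> 1 / 2"
    by auto
  define N where "N = Max (insert 1 F)"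
  have S1: "1 \<in> S N" by (auto simp: S_def)
  have gt: "n > N" if n: "n \<in> S N" "n \<noteq> 1" for n
  proof -
    obtain q where q: "prime q" "q dvd n" using n(2) prime_factor_nat by blast
    hence "q > N" using n by (auto simp: S_def not_le)
    moreover have "q \<le> n" using q n by (auto simp: S_def intro!: dvd_imp_le)
    ultimately show ?thesis by simp
  qed
  have rem: "S N - {1} \<subseteq> {1..} - F"
  proof
    fix n assume n: "n \<in> S N - {1}"
    have "n \<notin> F" using gt[of n] n F(1) Max_ge[of "insert 1 F" n] unfolding N_def by auto
    thus "n \<in> {1..} - F" using n S_sub by blast
  qed
  have "infsum t (S N) = infsum t {1} + infsum t (S N - {1})"
    using infsum_Un_disjoint[of t "{1}" "S N - {1}"] S1 tS[of "S N - {1}"] S_sub[of N]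
    by (simp add: insert_absorb) blast
  hence "infsum t (S N - {1}) = - 1" using zero[of N] by (simp add: t_def add_eq_0_iff)
  hence "1 = norm (infsum t (S N - {1}))" by simp
  also have "\<dots> \<le> infsum (\<lambda>n. norm (t n)) (S N - {1})"
    by (intro norm_infsum_bound tS) (use S_sub in blast)
  also have "\<dots> \<le> infsum (\<lambda>n. norm (t n)) ({1..} - F)"
    by (intro infsum_mono2 tS rem) (use S_sub in auto)
  also have "\<dots> = infsum (\<lambda>n. norm (t n)) {1..} - infsum (\<lambda>n. norm (t n)) F"
    using F by (intro infsum_Diff tn) (auto intro: summable_on_finite)
  also have "\<dots> \<le> 1 / 2" using F(3) unfolding infsum_finite[OF F(1)] dist_real_def by linarith
  finally show False by simp
qed

lemma zeta_tendsto_1: "((\<lambda>\<sigma>. zeta (Complex \<sigma> t)) \<longlongrightarrow> 1) at_top"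
proof -
  define a where "a = (\<lambda>k \<sigma>. 1 / of_nat (Suc k) powr Complex \<sigma> t)"
  define b where "b = (\<lambda>k::nat. if k = 0 then 1 else 0 :: complex)"
  have lim: "((\<lambda>\<sigma>. a k \<sigma>) \<longlongrightarrow> b k) at_top" for k
  proof (cases "k = 0")
    case True
    thus ?thesis by (simp add: a_def b_def)
  next
    case False
    have "((\<lambda>\<sigma>. x powr (- \<sigma>)) \<longlongrightarrow> 0) at_top" if "x > 1" for x :: real
      using that by real_asymp
    from this[of "real (Suc k)"] have "((\<lambda>\<sigma>. norm (a k \<sigma>)) \<longlongrightarrow> 0) at_top"
      unfolding a_def norm_inverse_nat_powr using False by simp
    thus ?thesis using False by (simp add: b_def tendsto_norm_zero_iff)
  qed
  have "eventually (\<lambda>\<sigma>. \<forall>k. norm (a k \<sigma>) \<le> real (Suc k) powr (- 2)) at_top"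
    using eventually_ge_at_top[of 2]
  proof eventually_elim
    case (elim \<sigma>)
    show ?case unfolding a_def norm_inverse_nat_powr using elim by (auto intro!: powr_mono)
  qed
  hence bound: "eventually (\<lambda>(k, \<sigma>). norm (a k \<sigma>) \<le> real (Suc k) powr (- 2)) (at_top \<times>\<^sub>F at_top)"
    unfolding eventually_prod_filter
    by (intro exI[of _ "\<lambda>_. True"] exI[of _ "\<lambda>\<sigma>. \<forall>k. norm (a k \<sigma>) \<le> real (Suc k) powr (- 2)"]) auto
  have "summable (\<lambda>k. real (Suc k) powr (- 2))"
    by (subst summable_Suc_iff) (simp add: summable_real_powr_iff)
  from tannerys_theorem[OF lim bound this]
  have "((\<lambda>\<sigma>. \<Sum>k. a k \<sigma>) \<longlongrightarrow> (\<Sum>k. b k)) at_top" by simp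
  also have "(\<Sum>k. b k) = 1"
    by (subst suminf_finite[of "{0}"]) (auto simp: b_def)
  finally have "((\<lambda>\<sigma>. \<Sum>k. a k \<sigma>) \<longlongrightarrow> 1) at_top" .
  moreover have "eventually (\<lambda>\<sigma>. (\<Sum>k. a k \<sigma>) = zeta (Complex \<sigma> t)) at_top"
    using eventually_gt_at_top[of 1]
  proof eventually_elim
    case (elim \<sigma>)
    thus ?case using zeta_sums[of "Complex \<sigma> t"] by (simp add: a_def sums_iff)
  qed
  ultimately show ?thesis by (rule Lim_transform_eventually)
qed

text \<open>Since \<open>s\<close> and \<open>1 - s\<close> give the same argument of
  \<open>Xi\<close>, both are zeros of \<open>zeta\<close>; nonvanishing for real part above 1,
  applied to each, leaves the closed strip.\<close>

lemma Xi_zero_imp_zeta_zero: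
  assumes "Xi (s - s ^ 2) = 0"
  shows "s \<noteq> 0" "s \<noteq> 1" "zeta s = 0" "0 \<le> Re s" "Re s \<le> 1"
proof -
  show s: "s \<noteq> 0" "s \<noteq> 1" using assms Xi_0 by auto
  show "zeta s = 0" using zeta_eq_Xi[OF s(2)] assms by simp
  thus "Re s \<le> 1" using zeta_nonzero[of s] by force
  have e: "(1 - s) - (1 - s) ^ 2 = s - s ^ 2" by (simp add: power2_eq_square algebra_simps)
  have "1 - s \<noteq> 1" using s by simp
  from zeta_eq_Xi[OF this, unfolded e assms] have "zeta (1 - s) = 0" by simp
  thus "0 \<le> Re s" using zeta_nonzero[of "1 - s"] by force
qed

lemma zeta_zero_imp_Xi_zero:
  assumes "s \<noteq> 1" "zeta s = 0" "Re s \<ge> 0"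
  shows "Xi (s - s ^ 2) = 0"
  using zeta_eq_Xi[OF assms(1)] assms rGamma_shift_nonzero[OF assms(3)] by (auto simp: powr_def)

lemma quadratic_preimage:
  obtains s :: complex where "w = s - s ^ 2"
proof
  show "w = (1 / 2 + csqrt (1 / 4 - w)) - (1 / 2 + csqrt (1 / 4 - w)) ^ 2"
  proof -
    have "(1 / 2 + c) - (1 / 2 + c) ^ 2 = 1 / 4 - c ^ 2" for c :: complex
      by (simp add: power2_eq_square algebra_simps)
    thus ?thesis by simp
  qed
qed

text \<open>For \<open>w = s - s^2\<close> the real part is
  \<open>Re s * (1 - Re s) + (Im s)^2\<close>, nonnegative in the closed strip. It could vanish only
  at \<open>s = 0\<close> or \<open>s = 1\<close>, which are excluded.\<close>

lemma Re_Xi_zero_pos: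
  assumes "Xi w = 0"
  shows "Re w > 0"
proof -
  obtain s where w: "w = s - s ^ 2" using quadratic_preimage .
  note s = Xi_zero_imp_zeta_zero[OF assms[unfolded w]]
  have Re_w: "Re w = Re s * (1 - Re s) + Im s ^ 2"
    by (simp add: w power2_eq_square algebra_simps)
  show ?thesis
  proof (cases "Im s = 0")
    case True
    hence "Re s \<noteq> 0" "Re s \<noteq> 1" using s by (auto simp: complex_eq_iff)
    thus ?thesis using s(4,5) Re_w by (auto intro!: add_pos_nonneg mult_pos_pos)
  next
    case False
    thus ?thesis using s(4,5) Re_w by (auto intro!: add_nonneg_pos mult_nonneg_nonneg)
  qed
qed

lemma norm_one_plus_ge:
  assumes "Re \<rho> > 0" "x \<ge> 0"
  shows "1 + x * (Re \<rho> / norm \<rho> ^ 2) \<le> norm (1 + of_real x / \<rho>)"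
proof -
  have "Re (1 + of_real x / \<rho>) = 1 + x * (Re \<rho> / norm \<rho> ^ 2)"
    by (simp add: Re_divide cmod_power2)
  thus ?thesis using complex_Re_le_cmod[of "1 + of_real x / \<rho>"] by simp
qed

lemma norm_one_plus_ge_1:
  assumes "Re \<rho> > 0" "x \<ge> 0"
  shows "1 \<le> norm (1 + of_real x / \<rho>)"
proof -
  have "0 \<le> x * (Re \<rho> / norm \<rho> ^ 2)" using assms by simp
  thus ?thesis using norm_one_plus_ge[OF assms] by linarith
qed

text \<open>The listing counts orders of \<open>zeta\<close>, the factorisation orders in
  \<open>w\<close>. They agree since \<open>s - s^2 - w0 = (1 - s - s0) * (s - s0)\<close>, and the
  first factor is nonzero at \<open>s0\<close> because \<open>Im s0 \<noteq> 0\<close>.\<close>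

lemma zorder_zeta_eq_zorder_Xi:
  assumes z: "zeta s0 = 0" "s0 \<noteq> 1" and Re: "Re s0 = 1 / 2" and Im: "Im s0 \<noteq> 0"
  shows "zorder zeta s0 = zorder (\<lambda>w. 2 * Xi w) (s0 - s0 ^ 2)"
proof -
  define F where "F = (\<lambda>w. 2 * Xi w)"
  define w0 where "w0 = s0 - s0 ^ 2"
  have hol: "F holomorphic_on UNIV" unfolding F_def by (intro holomorphic_intros Xi_holomorphic)
  have F0: "F w0 = 0" using zeta_zero_imp_Xi_zero[of s0] z Re by (simp add: F_def w0_def)
  obtain G r where G: "r > 0" "G holomorphic_on cball w0 r" "zorder F w0 > 0"
      "\<And>w. w \<in> cball w0 r \<Longrightarrow> F w = G w * (w - w0) ^ nat (zorder F w0) \<and> G w \<noteq> 0"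
  proof -
    have "\<exists>w\<in>UNIV. F w \<noteq> 0" using Xi_0 by (intro bexI[of _ 0]) (auto simp: F_def)
    from zorder_exist_zero[OF hol open_UNIV connected_UNIV UNIV_I this, of w0] F0 that
    show thesis by auto
  qed
  define n where "n = nat (zorder F w0)"
  define q where "q = (\<lambda>s::complex. of_real pi powr (s / 2) * rGamma (s / 2 + 1) / (s - 1))"
  define E where "E = (\<lambda>s. q s / 2)"
  define V where "V = {s. Re s > 0} \<inter> - {1} \<inter> (\<lambda>s. s - s ^ 2) -` ball w0 r"
  have "open V"
    unfolding V_def by (intro open_Int open_halfspace_Re_gt open_vimage) (auto intro!: continuous_intros)
  have "zorder zeta s0 = int n"
  proof (rule zorder_eqI[of V _ "\<lambda>s. E s * G (s - s ^ 2) * (1 - s - s0) ^ n"])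
    show "s0 \<in> V" using Re z G(1) by (auto simp: V_def w0_def)
    show "(\<lambda>s. E s * G (s - s ^ 2) * (1 - s - s0) ^ n) holomorphic_on V"
      unfolding E_def q_def
      by (intro holomorphic_intros holomorphic_on_compose_gen[OF _ G(2), unfolded o_def]
          holomorphic_on_compose_gen[OF _ holomorphic_rGamma[of UNIV], unfolded o_def]) (auto simp: V_def)
    have "E s0 \<noteq> 0" using rGamma_shift_nonzero[of s0] Re z by (auto simp: E_def q_def powr_def)
    moreover have "1 - s0 - s0 \<noteq> 0" using Im by (auto simp: complex_eq_iff)
    moreover have "G (s0 - s0 ^ 2) \<noteq> 0" using G(4)[of w0] G(1) by (simp add: w0_def)
    ultimately show "E s0 * G (s0 - s0 ^ 2) * (1 - s0 - s0) ^ n \<noteq> 0" by simp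
    fix s assume s: "s \<in> V"
    have "zeta s = F (s - s ^ 2) * E s"
    proof -
      have "zeta s = Xi (s - s ^ 2) * q s"
        using zeta_eq_Xi[of s] s by (simp add: V_def q_def mult.assoc)
      thus ?thesis by (simp add: F_def E_def)
    qed
    also have "F (s - s ^ 2) = G (s - s ^ 2) * (s - s ^ 2 - w0) ^ n"
      using G(4)[of "s - s ^ 2"] s by (simp add: V_def n_def)
    also have "s - s ^ 2 - w0 = (1 - s - s0) * (s - s0)"
      by (simp add: w0_def power2_eq_square algebra_simps)
    finally show "zeta s = E s * G (s - s ^ 2) * (1 - s - s0) ^ n * (s - s0) powi int n"
      by (simp add: power_mult_distrib mult_ac)
  qed fact
  thus ?thesis using G(3) by (simp add: n_def F_def w0_def)
qed

section \<open>The product over the zeros on the critical line\<close>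

lemma one_plus_sum_le_prod:
  fixes f :: "nat \<Rightarrow> real"
  assumes "\<And>n. f n \<ge> 0"
  shows "1 + (\<Sum>n<N. f n) \<le> (\<Prod>n<N. 1 + f n)"
proof (induction N)
  case (Suc N)
  have "(\<Prod>n<N. 1 + f n) \<ge> 1" using assms by (intro prod_ge_1) simp
  hence "f N * 1 \<le> f N * (\<Prod>n<N. 1 + f n)" using assms by (intro mult_left_mono)
  thus ?case using Suc by (simp add: algebra_simps)
qed simp

lemma critical_line_quadratic:
  assumes "Re s = 1 / 2"
  shows "s - s ^ 2 = of_real ((cmod s)\<^sup>2)"
proof -
  have "1 - s = cnj s" using assms by (simp add: complex_eq_iff)
  moreover have "s - s ^ 2 = s * (1 - s)" by (simp add: power2_eq_square algebra_simps)
  ultimately show ?thesis using complex_norm_square[of s] by simp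
qed

locale critical_zero_listing =
  fixes z :: "nat \<Rightarrow> complex"
  assumes listing: "lists_critical_line_zeros z"
begin

definition F :: "complex \<Rightarrow> complex" where "F w = 2 * Xi w"

definition a :: "nat \<Rightarrow> real" where "a n = (cmod (z n))\<^sup>2"

definition A :: "nat \<Rightarrow> complex" where "A n = of_real (a n)"

lemma F_holomorphic: "F holomorphic_on UNIV"
  unfolding F_def by (intro holomorphic_intros Xi_holomorphic)

lemma F_0: "F 0 = 1"
  by (simp add: F_def Xi_0)

lemma F_growth: "\<epsilon> > 0 \<Longrightarrow> \<exists>C. \<forall>w. norm (F w) \<le> C * exp (\<epsilon> * norm w)"
  unfolding F_def by (rule Xi_growth)

lemma F_zero_Re_pos: "F \<rho> = 0 \<Longrightarrow> Re \<rho> > 0"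
  using Re_Xi_zero_pos[of \<rho>] by (simp add: F_def)

lemma z_critical: "z n \<noteq> 1" "zeta (z n) = 0" "Re (z n) = 1 / 2" "Im (z n) > 0"
proof -
  have "z n \<in> critical_line_zeros" using listing by (auto simp: lists_critical_line_zeros_def)
  thus "z n \<noteq> 1" "zeta (z n) = 0" "Re (z n) = 1 / 2" "Im (z n) > 0"
    by (auto simp: critical_line_zeros_def zeta_zeros_def)
qed

lemma A_eq: "A n = z n - z n ^ 2"
  using critical_line_quadratic[OF z_critical(3)] by (simp add: A_def a_def)

lemma a_pos: "a n > 0"
  using z_critical(3)[of n] by (auto simp: a_def)

lemma A_zero: "F (A n) = 0"
  using zeta_zero_imp_Xi_zero[of "z n"] z_critical[of n] by (simp add: F_def A_eq)

text \<open>Equal values mean \<open>z m = z n\<close> or \<open>z m + z n = 1\<close>; the latter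
  contradicts the positive imaginary parts.\<close>

lemma A_eq_iff: "A m = A n \<longleftrightarrow> z m = z n"
proof
  assume "A m = A n"
  hence "(z m - z n) * (1 - z m - z n) = 0"
    by (simp add: A_eq power2_eq_square algebra_simps)
  moreover have "1 - z m - z n \<noteq> 0"
    using z_critical(4)[of m] z_critical(4)[of n] by (auto simp: complex_eq_iff)
  ultimately show "z m = z n" by simp
qed (simp add: A_eq)

lemma fibre: "finite {k. A k = A n}" "card {k. A k = A n} = nat (zorder F (A n))"
proof -
  have "z n \<in> critical_line_zeros" using listing by (auto simp: lists_critical_line_zeros_def)
  hence "finite {k. z k = z n}" "int (card {k. z k = z n}) = zorder zeta (z n)"
    using listing by (auto simp: lists_critical_line_zeros_def)
  moreover have "zorder zeta (z n) = zorder F (A n)"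
  proof -
    have "F = (\<lambda>w. 2 * Xi w)" by (simp add: F_def fun_eq_iff)
    thus ?thesis using zorder_zeta_eq_zorder_Xi[of "z n"] z_critical[of n] by (simp add: A_eq)
  qed
  ultimately show "finite {k. A k = A n}" "card {k. A k = A n} = nat (zorder F (A n))"
    by (auto simp: A_eq_iff)
qed

lemma finite_zeros: "finite {\<rho>. norm \<rho> \<le> R \<and> F \<rho> = 0}"
  by (rule finite_zeros_cball[OF F_holomorphic, of 0]) (simp add: F_0)

lemma finite_indices: "finite {n. a n \<le> R}"
proof (rule finite_subset)
  define Z where "Z = {\<rho>. norm \<rho> \<le> R \<and> F \<rho> = 0} \<inter> range A"
  show "{n. a n \<le> R} \<subseteq> (\<Union>\<rho>\<in>Z. {k. A k = \<rho>})"
    using A_zero a_pos by (auto simp: Z_def A_def abs_of_pos)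
  have "finite Z" using finite_zeros by (auto simp: Z_def)
  moreover have "finite {k. A k = \<rho>}" if "\<rho> \<in> Z" for \<rho>
    using that fibre(1) by (auto simp: Z_def)
  ultimately show "finite (\<Union>\<rho>\<in>Z. {k. A k = \<rho>})" by blast
qed

text \<open>A listed zero occurs at as many indices as its order, so its power unfolds into a
  product over indices; the second factor collects the zeros off the critical line.\<close>

lemma zeros_product_split:
  "zeros_product F R w = (\<Prod>n | a n \<le> R. 1 - w / A n) *
     (\<Prod>\<rho>\<in>{\<rho>. norm \<rho> \<le> R \<and> F \<rho> = 0} - range A. (1 - w / \<rho>) ^ nat (zorder F \<rho>))"
proof -
  define Z where "Z = {\<rho>. norm \<rho> \<le> R \<and> F \<rho> = 0}"
  define g where "g = (\<lambda>\<rho>. (1 - w / \<rho>) ^ nat (zorder F \<rho>))"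
  have finZ: "finite Z" unfolding Z_def by (rule finite_zeros)
  have norm_A: "norm (A n) = a n" for n using a_pos[of n] by (simp add: A_def)
  have "prod g (Z \<inter> range A) = (\<Prod>\<rho>\<in>Z \<inter> range A. \<Prod>n\<in>{n \<in> {n. a n \<le> R}. A n = \<rho>}. 1 - w / A n)"
  proof (intro prod.cong refl)
    fix \<rho> assume "\<rho> \<in> Z \<inter> range A"
    then obtain m where m: "\<rho> = A m" "norm \<rho> \<le> R" by (auto simp: Z_def)
    hence "{n \<in> {n. a n \<le> R}. A n = \<rho>} = {n. A n = A m}"
      using norm_A by auto metis
    hence "(\<Prod>n\<in>{n \<in> {n. a n \<le> R}. A n = \<rho>}. 1 - w / A n) = (\<Prod>n\<in>{n. A n = A m}. 1 - w / A m)"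
      by (auto intro!: prod.cong)
    also have "\<dots> = g \<rho>" by (simp add: fibre g_def m)
    finally show "g \<rho> = (\<Prod>n\<in>{n \<in> {n. a n \<le> R}. A n = \<rho>}. 1 - w / A n)" ..
  qed
  also have "\<dots> = (\<Prod>n | a n \<le> R. 1 - w / A n)"
    by (rule prod.group) (use finZ finite_indices A_zero norm_A in \<open>auto simp: Z_def\<close>)
  finally have "prod g (Z \<inter> range A) = (\<Prod>n | a n \<le> R. 1 - w / A n)" .
  moreover have "prod g Z = prod g (Z \<inter> range A) * prod g (Z - range A)"
    using finZ by (subst prod.union_disjoint[symmetric]) (auto intro: prod.cong)
  ultimately show ?thesis by (simp add: zeros_product_def Z_def g_def)
qed

text \<open>At \<open>w = - x\<close> all factors have modulus at least 1, so omitting factors from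
  the truncated product only decreases it; then \<open>R\<close> tends to infinity.\<close>

lemma finite_products_le_norm_F:
  assumes x: "x \<ge> 0" and E: "finite E" "\<And>\<rho>. \<rho> \<in> E \<Longrightarrow> F \<rho> = 0 \<and> \<rho> \<notin> range A"
  shows "(\<Prod>n<N. 1 + x / a n) * (\<Prod>\<rho>\<in>E. norm (1 + of_real x / \<rho>)) \<le> norm (F (- of_real x))"
proof (rule tendsto_lowerbound)
  show "((\<lambda>R. norm (zeros_product F R (- of_real x))) \<longlongrightarrow> norm (F (- of_real x))) at_top"
    by (intro tendsto_norm zeros_product_tendsto F_holomorphic F_0 F_growth)
  \<comment> \<open>From this radius on, all indices below \<open>N\<close> and all of
    \<open>E\<close> occur among the truncated factors.\<close>
  define R0 where "R0 = Max (insert 0 (norm ` E \<union> a ` {..<N}))"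
  show "eventually (\<lambda>R. (\<Prod>n<N. 1 + x / a n) * (\<Prod>\<rho>\<in>E. norm (1 + of_real x / \<rho>)) \<le>
      norm (zeros_product F R (- of_real x))) at_top"
    using eventually_ge_at_top[of R0]
  proof eventually_elim
    case (elim R)
    define B where "B = {\<rho>. norm \<rho> \<le> R \<and> F \<rho> = 0} - range A"
    have finB: "finite B" unfolding B_def using finite_zeros by auto
    have le: "norm \<rho> \<le> R" if "\<rho> \<in> E" for \<rho>
      using elim E that unfolding R0_def by (intro order.trans[OF Max_ge elim[unfolded R0_def]]) auto
    have le': "a n \<le> R" if "n < N" for n
      using elim E that unfolding R0_def by (intro order.trans[OF Max_ge elim[unfolded R0_def]]) auto
    have 1: "(\<Prod>n<N. 1 + x / a n) \<le> (\<Prod>n | a n \<le> R. 1 + x / a n)"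
      using x a_pos less_imp_le[OF a_pos] le' by (intro prod_mono2 finite_indices) (auto intro!: add_nonneg_nonneg)
    have "(\<Prod>\<rho>\<in>E. norm (1 + of_real x / \<rho>)) \<le> (\<Prod>\<rho>\<in>E. norm (1 + of_real x / \<rho>) ^ nat (zorder F \<rho>))"
    proof (intro prod_mono conjI)
      fix \<rho> assume \<rho>: "\<rho> \<in> E"
      have "zorder F \<rho> > 0"
        using zorder_pos_at_zero[OF F_holomorphic, of 0 \<rho>] E(2)[OF \<rho>] F_0 by auto
      hence "1 \<le> nat (zorder F \<rho>)" by simp
      moreover have "1 \<le> norm (1 + of_real x / \<rho>)"
        using E(2)[OF \<rho>] F_zero_Re_pos x by (intro norm_one_plus_ge_1) auto
      ultimately show "norm (1 + of_real x / \<rho>) \<le> norm (1 + of_real x / \<rho>) ^ nat (zorder F \<rho>)"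
        using power_increasing[of 1 "nat (zorder F \<rho>)" "norm (1 + of_real x / \<rho>)"] by simp
    qed auto
    also have "\<dots> \<le> (\<Prod>\<rho>\<in>B. norm (1 + of_real x / \<rho>) ^ nat (zorder F \<rho>))"
    proof (intro prod_mono2 finB)
      fix \<rho> assume "\<rho> \<in> B - E"
      hence "1 \<le> norm (1 + of_real x / \<rho>)"
        using F_zero_Re_pos x by (intro norm_one_plus_ge_1) (auto simp: B_def)
      thus "1 \<le> norm (1 + of_real x / \<rho>) ^ nat (zorder F \<rho>)" by simp
    qed (use E le in \<open>auto simp: B_def\<close>)
    finally have 2: "(\<Prod>\<rho>\<in>E. norm (1 + of_real x / \<rho>)) \<le> (\<Prod>\<rho>\<in>B. norm (1 + of_real x / \<rho>) ^ nat (zorder F \<rho>))" .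
    have "norm (1 + of_real x / A n) = 1 + x / a n" for n
    proof -
      have "1 + of_real x / A n = of_real (1 + x / a n)" by (simp add: A_def)
      also have "norm \<dots> = 1 + x / a n" using x a_pos[of n] by (simp only: norm_of_real) simp
      finally show ?thesis .
    qed
    hence "norm (zeros_product F R (- of_real x)) = (\<Prod>n | a n \<le> R. 1 + x / a n) *
        (\<Prod>\<rho>\<in>B. norm (1 + of_real x / \<rho>) ^ nat (zorder F \<rho>))"
      unfolding zeros_product_split B_def[symmetric]
      by (simp add: norm_mult prod_norm[symmetric] norm_power)
    thus ?case
      using mult_mono[OF 1 2] x less_imp_le[OF a_pos] by (simp add: prod_nonneg)
  qed
qed simp

text \<open>Partial sums are below partial products, and those at \<open>x = 1\<close> are bounded
  by \<open>norm (F (- 1))\<close>.\<close>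

lemma summable_inverse_a: "summable (\<lambda>n. 1 / a n)"
proof (rule summableI_nonneg_bounded)
  fix N
  have "1 + (\<Sum>n<N. 1 / a n) \<le> (\<Prod>n<N. 1 + 1 / a n)"
    by (intro one_plus_sum_le_prod) (simp add: less_imp_le[OF a_pos])
  also have "\<dots> \<le> norm (F (- of_real 1))"
    using finite_products_le_norm_F[of 1 "{}" N] by simp
  finally show "(\<Sum>n<N. 1 / a n) \<le> norm (F (- 1))" by simp
qed (simp add: less_imp_le[OF a_pos])

text \<open>Genus 0, so the elementary factors are the \<open>1 - w / A n\<close> of
  \<open>h_prod\<close>. The locale supplies holomorphy, zeros and their orders for the infinite
  product.\<close>

sublocale W: weierstrass_product A "\<lambda>_. 0"
proof
  show "A n \<noteq> 0" for n using a_pos[of n] by (simp add: A_def)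
  have na: "norm (A n) = a n" for n using a_pos[of n] by (simp add: A_def)
  have "filterlim a at_top sequentially"
  proof -
    have "(\<lambda>n. inverse (a n)) \<longlonglongrightarrow> 0"
      using summable_LIMSEQ_zero[OF summable_inverse_a] by (simp add: inverse_eq_divide)
    thus ?thesis
      using filterlim_inverse_at_top[of "\<lambda>n. inverse (a n)" sequentially] a_pos by simp
  qed
  thus "filterlim A at_infinity sequentially"
    by (simp add: filterlim_norm_at_top_imp_at_infinity na)
  show "summable (\<lambda>n. (r / norm (A n)) ^ Suc 0)" for r
    using summable_mult[OF summable_inverse_a, of r] by (simp add: na)
qed

lemma W_f_eq: "W.f w = (\<Prod>n. 1 - w / A n)"
  by (simp add: W.f_def weierstrass_factor_def)

lemma W_f_limit: "(\<lambda>N. \<Prod>n<N. 1 - w / A n) \<longlonglongrightarrow> W.f w"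
proof -
  have "(\<lambda>n. 1 - w / A n) has_prod W.f w"
    using W.has_prod[of w] by (simp add: weierstrass_factor_def)
  thus ?thesis by (rule has_prod_imp_tendsto')
qed

lemma h_prod_eq: "h_prod z s = W.f (s - s ^ 2) / 2"
  by (simp add: h_prod_def W_f_eq A_def a_def)

text \<open>Since each \<open>a n\<close> is positive, \<open>1 - w / a n\<close> is largest in
  modulus on the circle \<open>norm w = x\<close> at \<open>w = - x\<close>. With \<open>E\<close>
  empty this bounds the growth of \<open>W.f\<close>; with one zero off the line it gives the gain
  for the converse.\<close>

lemma norm_W_f_mult_le:
  assumes x: "x \<ge> 0" and E: "finite E" "\<And>\<rho>. \<rho> \<in> E \<Longrightarrow> F \<rho> = 0 \<and> \<rho> \<notin> range A" and w: "norm w = x"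
  shows "norm (W.f w) * (\<Prod>\<rho>\<in>E. norm (1 + of_real x / \<rho>)) \<le> norm (F (- of_real x))"
proof (rule tendsto_upperbound)
  show "(\<lambda>N. norm (\<Prod>n<N. 1 - w / A n) * (\<Prod>\<rho>\<in>E. norm (1 + of_real x / \<rho>))) \<longlonglongrightarrow>
     norm (W.f w) * (\<Prod>\<rho>\<in>E. norm (1 + of_real x / \<rho>))"
    by (intro tendsto_intros W_f_limit)
  show "eventually (\<lambda>N. norm (\<Prod>n<N. 1 - w / A n) * (\<Prod>\<rho>\<in>E. norm (1 + of_real x / \<rho>)) \<le> norm (F (- of_real x))) sequentially"
  proof (intro always_eventually allI)
    fix N
    have "norm (\<Prod>n<N. 1 - w / A n) \<le> (\<Prod>n<N. 1 + x / a n)"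
      unfolding prod_norm[symmetric]
    proof (intro prod_mono conjI)
      fix n
      show "norm (1 - w / A n) \<le> 1 + x / a n"
        using norm_triangle_ineq4[of 1 "w / A n"] a_pos[of n] w by (simp add: norm_divide A_def)
    qed auto
    hence "norm (\<Prod>n<N. 1 - w / A n) * (\<Prod>\<rho>\<in>E. norm (1 + of_real x / \<rho>)) \<le>
      (\<Prod>n<N. 1 + x / a n) * (\<Prod>\<rho>\<in>E. norm (1 + of_real x / \<rho>))"
      by (intro mult_right_mono) (auto intro: prod_nonneg)
    also have "\<dots> \<le> norm (F (- of_real x))" by (rule finite_products_le_norm_F[OF x E])
    finally show "norm (\<Prod>n<N. 1 - w / A n) * (\<Prod>\<rho>\<in>E. norm (1 + of_real x / \<rho>)) \<le> norm (F (- of_real x))" .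
  qed
qed simp

text \<open>
  Both sides are the limit of the same finite products over zeros; for \<open>W.f\<close> the growth condition
  holds because \<open>cmod (W.f w) \<le> cmod (F (- cmod w))\<close>.
\<close>
lemma W_f_eq_F:
  assumes zeros: "\<And>\<rho>. F \<rho> = 0 \<Longrightarrow> \<rho> \<in> range A"
  shows "W.f w = F w"
proof -
  have eq0: "W.f \<rho> = 0 \<longleftrightarrow> F \<rho> = 0" for \<rho>
    using zeros[of \<rho>] A_zero by (auto simp: W.zero)
  have ord: "zorder W.f \<rho> = zorder F \<rho>" if \<rho>: "F \<rho> = 0" for \<rho>
  proof -
    from zeros[OF \<rho>] obtain n where n: "\<rho> = A n" by auto
    have "zorder F \<rho> > 0" using zorder_pos_at_zero[OF F_holomorphic, of 0 \<rho>] \<rho> F_0 by auto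
    moreover have "A -` {\<rho>} = {k. A k = A n}" using n by auto
    ultimately show ?thesis using fibre(2)[of n] by (simp add: W.zorder n)
  qed
  have "((\<lambda>R. zeros_product W.f R w) \<longlongrightarrow> W.f w) at_top"
  proof (rule zeros_product_tendsto)
    show "W.f 0 = 1" by (simp add: W_f_eq)
    fix \<epsilon> :: real assume "\<epsilon> > 0"
    from F_growth[OF this] obtain C where C: "\<And>w. norm (F w) \<le> C * exp (\<epsilon> * norm w)" by auto
    have "norm (W.f w) \<le> C * exp (\<epsilon> * norm w)" for w
      using norm_W_f_mult_le[of "norm w" "{}" w] C[of "- of_real (norm w)"] by simp
    thus "\<exists>C. \<forall>w. norm (W.f w) \<le> C * exp (\<epsilon> * norm w)" by blast
  qed (rule W.holomorphic)
  moreover have "zeros_product W.f R w = zeros_product F R w" for R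
    unfolding zeros_product_def eq0 by (intro prod.cong) (auto simp: ord)
  ultimately have "((\<lambda>R. zeros_product F R w) \<longlongrightarrow> W.f w) at_top" by simp
  moreover have "((\<lambda>R. zeros_product F R w) \<longlongrightarrow> F w) at_top"
    by (intro zeros_product_tendsto F_holomorphic F_0 F_growth)
  ultimately show ?thesis using tendsto_unique[OF trivial_limit_at_top_linorder] by blast
qed

text \<open>For \<open>Re s > 1\<close> the denominator is analytic and nonzero, so
  \<open>remove_sings\<close> keeps the value of the quotient. \<open>zeta\<close> and
  \<open>eta_of z\<close> then share a denominator, and comparing them amounts to comparing
  \<open>F\<close> with \<open>W.f\<close>.\<close>

lemma completing_factor:
  assumes s: "Re s > 1"
  defines "D \<equiv> (\<lambda>s. s / 2 * (s - 1) * of_real pi powr (- s / 2) * Gamma (s / 2))"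
  shows "D s \<noteq> 0" "zeta s = F (s - s ^ 2) / 2 / D s" "eta_of z s = W.f (s - s ^ 2) / 2 / D s"
proof -
  have s01: "s \<noteq> 0" "s \<noteq> 1" using s by auto
  have s2: "t / 2 \<notin> \<int>\<^sub>\<le>\<^sub>0" if "Re t > 1" for t :: complex
    using that by (auto elim!: nonpos_Ints_cases simp: complex_eq_iff)
  have G: "Gamma (s / 2 + 1) = s / 2 * Gamma (s / 2)"
    using Gamma_plus1[OF s2[OF s]] by simp
  show D0: "D s \<noteq> 0" using s2[OF s] s01 by (auto simp: D_def Gamma_eq_zero_iff powr_def)
  have e2: "of_real pi powr (s / 2) = 1 / (of_real pi powr (- s / 2))"
    by (simp add: powr_minus_divide)
  have e3: "rGamma (s / 2 + 1) = 1 / (s / 2 * Gamma (s / 2))"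
    unfolding G[symmetric] by (simp add: rGamma_inverse_Gamma inverse_eq_divide)
  show "zeta s = F (s - s ^ 2) / 2 / D s"
    unfolding zeta_eq_Xi[OF s01(2)] e2 e3 D_def F_def by (simp add: mult_ac)
  have "(\<lambda>s. W.f (s - s ^ 2) / 2 / D s) analytic_on {s}"
  proof -
    have "(\<lambda>s. W.f (s - s ^ 2)) holomorphic_on UNIV"
      by (intro holomorphic_on_compose_gen[OF _ W.holomorphic[of UNIV], unfolded o_def] holomorphic_intros) auto
    hence "(\<lambda>s. W.f (s - s ^ 2)) analytic_on {s}"
      by (auto intro: holomorphic_on_imp_analytic_at)
    moreover have "D holomorphic_on {t. Re t > 1}"
      unfolding D_def
      by (intro holomorphic_intros holomorphic_on_compose_gen[OF _ holomorphic_Gamma[of "- \<int>\<^sub>\<le>\<^sub>0"], unfolded o_def])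
         (use s2 in auto)
    hence "D analytic_on {s}"
      using s by (intro holomorphic_on_imp_analytic_at[of _ "{t. Re t > 1}"]) (auto simp: open_halfspace_Re_gt)
    ultimately show ?thesis using D0 by (intro analytic_intros) auto
  qed
  moreover have "eta_of z = remove_sings (\<lambda>s. W.f (s - s ^ 2) / 2 / D s)"
    unfolding eta_of_def h_prod_eq D_def ..
  ultimately show "eta_of z s = W.f (s - s ^ 2) / 2 / D s" by simp
qed

lemma riemann_hypothesis_imp_range:
  assumes RH: "riemann_hypothesis" and \<rho>: "F \<rho> = 0"
  shows "\<rho> \<in> range A"
proof -
  obtain s where s: "\<rho> = s - s ^ 2" using quadratic_preimage .
  have Xi0: "Xi (s - s ^ 2) = 0" using \<rho> by (simp add: F_def s)
  note zs = Xi_zero_imp_zeta_zero[OF Xi0]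
  have Re: "Re s = 1 / 2"
    using RH zs by (auto simp: riemann_hypothesis_def zeta_zeros_def)
  have Im: "Im s \<noteq> 0"
  proof
    assume "Im s = 0"
    hence "s = 1 / 2" using Re by (simp add: complex_eq_iff)
    hence "s - s ^ 2 = 1 / 4" by (simp only:) (simp add: power2_eq_square)
    thus False using Xi_quarter_nonzero Xi0 by (simp only:)
  qed
  \<comment> \<open>Both \<open>s\<close> and \<open>1 - s\<close> lie over \<open>\<rho>\<close>
    and on the critical line; the one in the upper half-plane is listed.\<close>
  define s' where "s' = (if Im s > 0 then s else 1 - s)"
  have s': "\<rho> = s' - s' ^ 2" "Re s' = 1 / 2" "Im s' > 0"
    using Re Im s by (auto simp: s'_def power2_eq_square algebra_simps)
  have "Xi (s' - s' ^ 2) = 0" using \<rho> s'(1) by (simp add: F_def)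
  from Xi_zero_imp_zeta_zero[OF this] have "s' \<in> critical_line_zeros"
    using s' by (auto simp: critical_line_zeros_def zeta_zeros_def)
  hence "s' \<in> range z" using listing by (simp add: lists_critical_line_zeros_def)
  then obtain n where "z n = s'" by auto
  thus ?thesis using s'(1) by (auto simp: A_eq)
qed

lemma riemann_hypothesis_imp_limit:
  assumes RH: "riemann_hypothesis"
  shows "((\<lambda>\<sigma>. eta_of z (Complex \<sigma> t)) \<longlongrightarrow> 1) at_top"
proof -
  have eq: "W.f w = F w" for w
    using riemann_hypothesis_imp_range[OF RH] by (rule W_f_eq_F)
  have "eventually (\<lambda>\<sigma>. zeta (Complex \<sigma> t) = eta_of z (Complex \<sigma> t)) at_top"
    using eventually_gt_at_top[of 1]
  proof eventually_elim
    case (elim \<sigma>)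
    thus ?case using completing_factor(2,3)[of "Complex \<sigma> t"] by (simp add: eq)
  qed
  with zeta_tendsto_1[of t] show ?thesis by (rule Lim_transform_eventually)
qed

text \<open>On the real ray \<open>w = - x\<close> with \<open>x = \<sigma>^2 - \<sigma>\<close>.
  The factor of a zero off the line has real part \<open>1 + x * c\<close> with
  \<open>c > 0\<close>, so it would force \<open>zeta\<close> to be unbounded where it tends to
  1.\<close>

lemma limit_imp_riemann_hypothesis:
  assumes lim: "((\<lambda>\<sigma>. eta_of z (Complex \<sigma> 0)) \<longlongrightarrow> 1) at_top"
  shows "riemann_hypothesis"
proof (rule ccontr)
  assume "\<not> riemann_hypothesis"
  then obtain s where s: "s \<noteq> 1" "zeta s = 0" "0 \<le> Re s" "Re s \<noteq> 1 / 2"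
    by (auto simp: riemann_hypothesis_def zeta_zeros_def)
  define w where "w = s - s ^ 2"
  have Fw: "F w = 0" using zeta_zero_imp_Xi_zero[of s] s by (simp add: F_def w_def)
  \<comment> \<open>A listed value over the same \<open>w\<close> would make \<open>s\<close> equal
    to \<open>z n\<close> or \<open>1 - z n\<close>, both of real part \<open>1/2\<close>.\<close>
  have w_notin: "w \<notin> range A"
  proof
    assume "w \<in> range A"
    then obtain n where "w = A n" by auto
    hence "(s - z n) * (1 - s - z n) = 0"
      by (simp add: w_def A_eq power2_eq_square algebra_simps)
    hence "s - z n = 0 \<or> 1 - s - z n = 0" by (simp only: mult_eq_0_iff)
    thus False using s(4) z_critical(3)[of n] by (auto simp: complex_eq_iff)
  qed
  define c where "c = Re w / norm w ^ 2"
  have c: "c > 0" using F_zero_Re_pos[OF Fw] by (auto simp: c_def intro!: divide_pos_pos)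
  have "eventually (\<lambda>\<sigma>. norm (eta_of z (Complex \<sigma> 0)) * (1 + (\<sigma> ^ 2 - \<sigma>) * c) \<le> norm (zeta (Complex \<sigma> 0))) at_top"
    using eventually_gt_at_top[of 1]
  proof eventually_elim
    case (elim \<sigma>)
    define S where "S = Complex \<sigma> 0"
    define x where "x = \<sigma> ^ 2 - \<sigma>"
    have x: "x \<ge> 0" using elim by (simp add: x_def power2_eq_square)
    have S: "S - S ^ 2 = - of_real x" by (simp add: S_def x_def complex_eq_iff power2_eq_square)
    have "norm (W.f (- of_real x)) * (1 + x * c) \<le> norm (W.f (- of_real x)) * norm (1 + of_real x / w)"
      unfolding c_def by (intro mult_left_mono norm_one_plus_ge F_zero_Re_pos Fw x) auto
    also have "\<dots> \<le> norm (F (- of_real x))"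
      using norm_W_f_mult_le[of x "{w}" "- of_real x"] x Fw w_notin by simp
    finally have "norm (W.f (S - S ^ 2)) * (1 + x * c) \<le> norm (F (S - S ^ 2))" unfolding S .
    moreover have "Re S > 1" using elim by (simp add: S_def)
    note completing_factor[OF this]
    ultimately have "norm (eta_of z S) * (1 + x * c) \<le> norm (zeta S)"
      by (simp only: norm_divide) (simp add: divide_simps)
    thus ?case by (simp add: S_def x_def)
  qed
  moreover have "filterlim (\<lambda>\<sigma>. norm (eta_of z (Complex \<sigma> 0)) * (1 + (\<sigma> ^ 2 - \<sigma>) * c)) at_top at_top"
  proof (rule filterlim_tendsto_pos_mult_at_top)
    show "((\<lambda>\<sigma>. norm (eta_of z (Complex \<sigma> 0))) \<longlongrightarrow> 1) at_top"
      using tendsto_norm[OF lim] by simp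
    show "filterlim (\<lambda>\<sigma>. 1 + (\<sigma> ^ 2 - \<sigma>) * c) at_top at_top"
      using c by real_asymp
  qed simp
  ultimately have "filterlim (\<lambda>\<sigma>. norm (zeta (Complex \<sigma> 0))) at_top at_top"
    by (rule filterlim_at_top_mono[rotated])
  moreover have "((\<lambda>\<sigma>. norm (zeta (Complex \<sigma> 0))) \<longlongrightarrow> 1) at_top"
    using tendsto_norm[OF zeta_tendsto_1[of 0]] by simp
  ultimately show False
    using not_tendsto_and_filterlim_at_infinity[of at_top "\<lambda>\<sigma>. norm (zeta (Complex \<sigma> 0))" 1]
    by (auto simp: filterlim_at_top_imp_at_infinity)
qed

end

theorem theorem2p4:
  fixes z :: "nat \<Rightarrow> complex"
  assumes "lists_critical_line_zeros z"
  shows "riemann_hypothesis \<longleftrightarrow>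
    (\<forall>t::real. ((\<lambda>\<sigma>::real. eta_of z (Complex \<sigma> t)) \<longlongrightarrow> 1) at_top)"
proof -
  interpret critical_zero_listing z
    by unfold_locales (rule assms)
  show ?thesis
    using riemann_hypothesis_imp_limit limit_imp_riemann_hypothesis by blast
qed

end
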